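(* Let $d \geq 1$, let $G=(V,E)$ be a degree $d$ hypertree with vertex set $V=\{x_1,\ldots,x_n\}$ (in which every vertex lies in some edge), and let $\kappa : V \to \{1,\ldots,d\}$ be a $d$-coloring of $G$. For $1 \leq i \leq d$, let $n_i = |\kappa^{-1}(i)|$ be the number of vertices of color $i$. Let $\mathbf{k}$ be an arbitrary field and let $I = I(G) \subset S = \mathbf{k}[x_1,\ldots,x_n]$ be the edge ideal of $G$. Then for all $j \geq 2$, $$\beta_{j-1}(I) \geq \sum_{i=1}^d \binom{n_i}{j}.$$
   Context: A hypergraph $G=(V,E)$ consists of a finite vertex set $V=\{x_1,\ldots,x_n\}$ and a set of edges $E \subset 2^V$ such that no edge is contained in another edge (edges of cardinality one are allowed). The degree of $G$ is the maximum size of an edge. $G$ is pure if all its edges have the same cardinality. A hypertree is a pure hypergraph whose edges can be enumerated $F_1,\ldots,F_{|E|}$ (with $|E| \geq 1$) so that $|F_i \setminus (F_1\cup\cdots\cup F_{i-1})| = 1$ for all $2 \leq i \leq |E|$. A $k$-coloring of $G$ is a function $\kappa: V \to \{1,\ldots,k\}$ such that no two distinct vertices with the same $\kappa$-value belong to the same edge. The edge ideal of $G$ is the squarefree monomial ideal $I(G) = (x_{i_1}\cdots x_{i_r} : \{x_{i_1},\ldots,x_{i_r}\}\in E)$ of the polynomial ring $S=\mathbf{k}[x_1,\ldots,x_n]$ with its standard $\mathbb{Z}$-grading. The Betti numbers are those of the ideal $I$ itself as an $S$-module (not of $S/I$): if $$0 \to \bigoplus_{a} S(-a)^{\beta_{l,a}}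 \to \cdots \to \bigoplus_a S(-a)^{\beta_{0,a}} \to I \to 0$$ is the minimal free $\mathbb{Z}$-graded resolution of $I$, then $\beta_{i,a}(I)=\beta_{i,a}$ and $\beta_i(I) = \sum_{a\in\mathbb{Z}} \beta_{i,a}(I)$, with $\beta_i(I)=0$ for $i$ beyond the length of the resolution. Also $\binom{m}{j}=0$ for $0\le m<j$. *)

theory Defs
  imports Complex_Main "HOL-Library.Poly_Mapping"
begin

section \<open>Hypergraphs\<close>

definition hypergraph :: "'v set \<Rightarrow> 'v set set \<Rightarrow> bool" where
  "hypergraph V E \<longleftrightarrow> finite V \<and> E \<subseteq> Pow V \<and> (\<forall>e\<in>E. \<forall>f\<in>E. e \<subseteq> f \<longrightarrow> e = f)"

definition hypergraph_degree :: "'v set set \<Rightarrow> nat" where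
  "hypergraph_degree E = Max (card ` E)"

definition pure :: "'v set set \<Rightarrow> bool" where
  "pure E \<longleftrightarrow> (\<forall>e\<in>E. \<forall>f\<in>E. card e = card f)"

definition hypertree :: "'v set \<Rightarrow> 'v set set \<Rightarrow> bool" where
  "hypertree V E \<longleftrightarrow> hypergraph V E \<and> pure E \<and>
     (\<exists>Fs. Fs \<noteq> [] \<and> distinct Fs \<and> set Fs = E \<and>
        (\<forall>i. 1 \<le> i \<and> i < length Fs \<longrightarrow> card (Fs ! i - \<Union> (set (take i Fs))) = 1))"

definition coloring :: "'v set \<Rightarrow> 'v set set \<Rightarrow> nat \<Rightarrow> ('v \<Rightarrow> nat) \<Rightarrow> bool" where
  "coloring V E k \<kappa> \<longleftrightarrow> \<kappa> ` V \<subseteq> {1..k} \<and>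
     (\<forall>u\<in>V. \<forall>v\<in>V. u \<noteq> v \<and> \<kappa> u = \<kappa> v \<longrightarrow> \<not> (\<exists>e\<in>E. u \<in> e \<and> v \<in> e))"


section \<open>The polynomial ring and edge ideals\<close>

text \<open>
  The ring \<open>k[x\<^sub>v : v \<in> V]\<close>: the variables are indexed by the elements of a type \<open>'v\<close>, which is
  of class \<open>finite\<close> wherever the number of variables has to be finite. Ideals are submodules of the
  ring over itself, so that the ideal generated by a set is its span.
\<close>

type_synonym ('v, 'k) polys = "('v \<Rightarrow>\<^sub>0 nat) \<Rightarrow>\<^sub>0 'k"

definition var :: "'v \<Rightarrow> ('v, 'k::field) polys" where
  "var v = Poly_Mapping.single (Poly_Mapping.single v 1) 1"

definition ideal_gen :: "'a::comm_ring_1 set \<Rightarrow> 'a set" where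
  "ideal_gen B = module.span (*) B"

definition edge_ideal :: "'v set set \<Rightarrow> ('v, 'k::field) polys set" where
  "edge_ideal E = ideal_gen ((\<lambda>e. \<Prod>v\<in>e. var v) ` E)"

definition irrelevant_ideal :: "('v, 'k::field) polys set" where
  "irrelevant_ideal = ideal_gen (range var)"

text \<open>The zero polynomial is homogeneous of every degree, and no other one is homogeneous of
  negative degree.\<close>

definition homogeneous :: "int \<Rightarrow> ('v::finite, 'k::field) polys \<Rightarrow> bool" where
  "homogeneous a p \<longleftrightarrow> (\<forall>m \<in> Poly_Mapping.keys p. int (\<Sum>v\<in>UNIV. Poly_Mapping.lookup m v) = a)"


section \<open>Minimal graded free resolutions and Betti numbers\<close>

text \<open>
  A complex \<open>\<dots> \<rightarrow> F\<^sub>1 \<rightarrow> F\<^sub>0 \<rightarrow> S\<close> of graded free modules. The module \<open>F\<^sub>i\<close> is the direct sum of the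
  \<open>S(-shift i b)\<close> over \<open>b \<in> basis i\<close>, that is, the basis element \<open>b\<close> has degree \<open>shift i b\<close>.
  The map from \<open>F\<^sub>i\<^sub>+\<^sub>1\<close> to \<open>F\<^sub>i\<close> is given by its matrix: the entry \<open>diff i p q\<close> is the coefficient at
  \<open>p \<in> basis i\<close> of the image of \<open>q \<in> basis (i + 1)\<close>. The map from \<open>F\<^sub>0\<close> to \<open>S\<close> sends \<open>q\<close> to \<open>aug q\<close>.
\<close>

record 'r graded_complex =
  basis :: "nat \<Rightarrow> nat set"
  shift :: "nat \<Rightarrow> nat \<Rightarrow> int"
  diff :: "nat \<Rightarrow> nat \<Rightarrow> nat \<Rightarrow> 'r"
  aug :: "nat \<Rightarrow> 'r"

definition free_mod :: "nat set \<Rightarrow> (nat \<Rightarrow> 'r::comm_ring_1) set" where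
  "free_mod B = {u. \<forall>b. b \<notin> B \<longrightarrow> u b = 0}"

definition diff_map ::
  "'r::comm_ring_1 graded_complex \<Rightarrow> nat \<Rightarrow> (nat \<Rightarrow> 'r) \<Rightarrow> (nat \<Rightarrow> 'r)" where
  "diff_map F i u = (\<lambda>p. if p \<in> basis F i then \<Sum>q\<in>basis F (i + 1). diff F i p q * u q else 0)"

definition aug_map ::
  "'r::comm_ring_1 graded_complex \<Rightarrow> (nat \<Rightarrow> 'r) \<Rightarrow> 'r" where
  "aug_map F u = (\<Sum>q\<in>basis F 0. aug F q * u q)"

text \<open>The conditions on the matrix entries say that the maps are homogeneous of degree zero.\<close>

definition graded_free_resolution ::
  "('v::finite, 'k::field) polys set \<Rightarrow> ('v, 'k) polys graded_complex \<Rightarrow> bool" where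
  "graded_free_resolution I F \<longleftrightarrow>
     (\<forall>i. finite (basis F i)) \<and>
     (\<exists>l. \<forall>i>l. basis F i = {}) \<and>
     (\<forall>i. \<forall>p\<in>basis F i. \<forall>q\<in>basis F (i + 1).
        homogeneous (shift F (i + 1) q - shift F i p) (diff F i p q)) \<and>
     (\<forall>q\<in>basis F 0. homogeneous (shift F 0 q) (aug F q)) \<and>
     aug_map F ` free_mod (basis F 0) = I \<and>
     {u \<in> free_mod (basis F 0). aug_map F u = 0} = diff_map F 0 ` free_mod (basis F 1) \<and>
     (\<forall>i. {u \<in> free_mod (basis F (i + 1)). diff_map F i u = (\<lambda>_. 0)}
            = diff_map F (i + 1) ` free_mod (basis F (i + 2)))"

text \<open>Minimality: the image of \<open>F\<^sub>i\<^sub>+\<^sub>1\<close> is contained in \<open>m F\<^sub>i\<close> for all \<open>i \<ge> 0\<close>, where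
  \<open>m\<close> is the irrelevant ideal.\<close>

definition minimal_graded_free_resolution ::
  "('v::finite, 'k::field) polys set \<Rightarrow> ('v, 'k) polys graded_complex \<Rightarrow> bool" where
  "minimal_graded_free_resolution I F \<longleftrightarrow>
     graded_free_resolution I F \<and>
     (\<forall>i. \<forall>p\<in>basis F i. \<forall>q\<in>basis F (i + 1). diff F i p q \<in> irrelevant_ideal)"

text \<open>Every homogeneous ideal has a minimal graded free resolution of finite length, and any two of
  them are isomorphic as graded complexes; hence the numbers below do not depend on the choice.\<close>

definition minimal_resolution ::
  "('v::finite, 'k::field) polys set \<Rightarrow> ('v, 'k) polys graded_complex" where
  "minimal_resolution I = (SOME F. minimal_graded_free_resolution I F)"

definition graded_betti :: "('v::finite, 'k::field) polys set \<Rightarrow> nat \<Rightarrow> int \<Rightarrow> nat" where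
  "graded_betti I i a =
     card {b \<in> basis (minimal_resolution I) i. shift (minimal_resolution I) i b = a}"

text \<open>\<^const>\<open>Sum_any\<close> sums over the support, here the finite set of all \<open>a\<close> with
  \<open>graded_betti I i a \<noteq> 0\<close>.\<close>

definition betti :: "('v::finite, 'k::field) polys set \<Rightarrow> nat \<Rightarrow> nat" where
  "betti I i = Sum_any (graded_betti I i)"

end

theory Submission
  imports Defs "HOL-Library.Function_Algebras"
begin

text \<open>
  The edge ideal has a minimal resolution that is graded by sets of vertices. In such a resolution
  the basis elements whose degree lies in an interval \<open>[U, W]\<close> form a subquotient complex, and adding
  a vertex to \<open>U\<close> and \<open>W\<close> passes to the quotient of one such complex by another. Let \<open>P\<close> be the set of
  vertices of one colour in an initial segment of the edges, and \<open>Y\<close> the set of the other vertices in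
  it. Every edge contains exactly one vertex of each colour, so \<open>Y\<close> contains no edge while \<open>Y \<union> {x}\<close>
  does for \<open>x \<in> P\<close>. Hence for \<open>A \<subseteq> P\<close> the homology of the interval \<open>[A, Y \<union> A]\<close> does not vanish at level
  \<open>card A\<close>, and there is a basis element of that level with degree in this interval. Choosing the
  shortest initial segment containing \<open>A\<close>, distinct monochromatic sets \<open>A\<close> get distinct basis elements.

  The bound carries over to any resolution, since the ranks of a minimal one are the smallest.
\<close>

section \<open>Ranks of minimal complexes\<close>

text \<open>The Betti numbers are read off a Z-graded resolution picked by \<open>SOME\<close>,
  which carries no vertex sets. The counting is therefore done in a resolution built by hand, and a
  comparison of ranks leads back to the chosen one. In a resolution with squarefree degrees,
  multidegrees with equal support have the same strand, so sets of vertices suffice as degrees and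
  the counting is linear algebra over the field.

  The homology class starts at level 0: the strand of \<open>Y\<close> has no generator at level 1,
  so the ring survives there, while the strand of \<open>Y\<close> together with any nonempty part
  of \<open>P\<close> is exact. Each vertex moved into \<open>A\<close> passes to a quotient of an
  exact complex, whose connecting map raises the level by one.

  The obstacle in the counting is the colour: a degree in \<open>[A, Y \<union> A]\<close> may
  contain vertices of many colours, so intervals belonging to different colours may overlap. The
  single new vertex of the last edge reveals the colour. The first edge has no such distinguished
  vertex; it is excluded by j \<ge> 2, because its vertices have distinct colours.\<close>

definition mat_vec :: "nat set \<Rightarrow> (nat \<Rightarrow> nat \<Rightarrow> 'r::comm_ring_1) \<Rightarrow> (nat \<Rightarrow> 'r) \<Rightarrow> nat \<Rightarrow> 'r" where
  "mat_vec A X u = (\<lambda>p. \<Sum>q\<in>A. X p q * u q)"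

definition mat_mult ::
  "nat set \<Rightarrow> (nat \<Rightarrow> nat \<Rightarrow> 'r::comm_ring_1) \<Rightarrow> (nat \<Rightarrow> nat \<Rightarrow> 'r) \<Rightarrow> nat \<Rightarrow> nat \<Rightarrow> 'r" where
  "mat_mult A X Y = (\<lambda>p r. \<Sum>q\<in>A. X p q * Y q r)"

text \<open>Vanishing outside the index sets turns equality of linear maps into plain equality of
  functions.\<close>

definition matrices :: "nat set \<Rightarrow> nat set \<Rightarrow> (nat \<Rightarrow> nat \<Rightarrow> 'r::comm_ring_1) set" where
  "matrices A B = {X. \<forall>p q. p \<notin> A \<or> q \<notin> B \<longrightarrow> X p q = 0}"

definition unit_mat :: "nat set \<Rightarrow> nat \<Rightarrow> nat \<Rightarrow> 'r::comm_ring_1" where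
  "unit_mat A = (\<lambda>p q. if p = q \<and> p \<in> A then 1 else 0)"

definition unit_vec :: "nat \<Rightarrow> nat \<Rightarrow> 'r::comm_ring_1" where
  "unit_vec a = (\<lambda>b. if b = a then 1 else 0)"

lemma free_mod_zero [simp]: "0 \<in> free_mod A"
  by (simp add: free_mod_def)

lemma free_mod_add: "u \<in> free_mod A \<Longrightarrow> v \<in> free_mod A \<Longrightarrow> u + v \<in> free_mod A"
  by (simp add: free_mod_def)

lemma free_mod_diff: "u \<in> free_mod A \<Longrightarrow> v \<in> free_mod A \<Longrightarrow> u - v \<in> free_mod A"
  by (simp add: free_mod_def)

lemma free_mod_mono: "u \<in> free_mod A \<Longrightarrow> A \<subseteq> B \<Longrightarrow> u \<in> free_mod B"
  by (auto simp: free_mod_def)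

lemma mat_vec_zero [simp]: "mat_vec A X 0 = 0"
  by (simp add: mat_vec_def fun_eq_iff)

lemma mat_vec_add: "mat_vec A X (u + v) = mat_vec A X u + mat_vec A X v"
  by (simp add: mat_vec_def fun_eq_iff distrib_left sum.distrib)

lemma mat_vec_diff: "mat_vec A X (u - v) = mat_vec A X u - mat_vec A X v"
  by (simp add: mat_vec_def fun_eq_iff right_diff_distrib sum_subtractf)

lemma mat_vec_mat_vec: "mat_vec A X (mat_vec B Y u) = mat_vec B (mat_mult A X Y) u"
  unfolding mat_vec_def mat_mult_def fun_eq_iff sum_distrib_left sum_distrib_right
  by (subst sum.swap) (simp add: mult.assoc)

lemma mat_vec_zero_left [simp]: "mat_vec A 0 u = 0"
  by (simp add: mat_vec_def fun_eq_iff)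

lemma mat_mult_assoc: "mat_mult A X (mat_mult B Y Z) = mat_mult B (mat_mult A X Y) Z"
  unfolding mat_mult_def fun_eq_iff sum_distrib_left sum_distrib_right
  by (subst sum.swap) (simp add: mult.assoc)

lemma mat_mult_zero [simp]: "mat_mult A X 0 = 0" "mat_mult A 0 X = 0"
  by (simp_all add: mat_mult_def fun_eq_iff)

lemma mat_mult_diff:
  "mat_mult A X (Y - Z) = mat_mult A X Y - mat_mult A X Z"
  "mat_mult A (X - Y) Z = mat_mult A X Z - mat_mult A Y Z"
  by (simp_all add: mat_mult_def fun_eq_iff right_diff_distrib left_diff_distrib sum_subtractf)

lemma mat_mult_add:
  "mat_mult A X (Y + Z) = mat_mult A X Y + mat_mult A X Z"
  "mat_mult A (X + Y) Z = mat_mult A X Z + mat_mult A Y Z"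
  by (simp_all add: mat_mult_def fun_eq_iff distrib_left distrib_right sum.distrib)

lemma matrices_zero [simp]: "0 \<in> matrices A B"
  by (simp add: matrices_def)

lemma matrices_diff: "X \<in> matrices A B \<Longrightarrow> Y \<in> matrices A B \<Longrightarrow> X - Y \<in> matrices A B"
  by (auto simp: matrices_def)

lemma unit_mat_matrices: "unit_mat A \<in> matrices A A"
  by (simp add: matrices_def unit_mat_def)

lemma mat_mult_matrices: "X \<in> matrices A B \<Longrightarrow> Y \<in> matrices B C \<Longrightarrow> mat_mult B X Y \<in> matrices A C"
  by (auto simp: matrices_def mat_mult_def)

lemma mat_mult_unit_mat:
  assumes "finite A"
  shows "X \<in> matrices B A \<Longrightarrow> mat_mult A X (unit_mat A) = X"
    and "Y \<in> matrices A B \<Longrightarrow> mat_mult A (unit_mat A) Y = Y"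
proof -
  show "mat_mult A X (unit_mat A) = X" if "X \<in> matrices B A"
  proof (intro ext)
    fix p r
    have "mat_mult A X (unit_mat A) p r = (\<Sum>q\<in>A. if q = r then X p r else 0)"
      unfolding mat_mult_def unit_mat_def by (intro sum.cong) auto
    also have "\<dots> = X p r" using assms that by (auto simp: matrices_def)
    finally show "mat_mult A X (unit_mat A) p r = X p r" .
  qed
  show "mat_mult A (unit_mat A) Y = Y" if "Y \<in> matrices A B"
  proof (intro ext)
    fix p r
    have "mat_mult A (unit_mat A) Y p r = (\<Sum>q\<in>A. if p = q then Y p r else 0)"
      unfolding mat_mult_def unit_mat_def by (intro sum.cong) auto
    also have "\<dots> = Y p r" using assms that by (auto simp: matrices_def)
    finally show "mat_mult A (unit_mat A) Y p r = Y p r" .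
  qed
qed

lemma unit_vec_free: "q \<in> A \<Longrightarrow> unit_vec q \<in> free_mod A"
  by (auto simp: free_mod_def unit_vec_def)

lemma mat_vec_unit_vec:
  assumes "finite B" "q \<in> B"
  shows "mat_vec B t (unit_vec q) = (\<lambda>p. t p q)"
  using assms by (simp add: mat_vec_def unit_vec_def if_distrib[of "(*) _"] cong: if_cong)

lemma mat_mult_zeroI:
  assumes "finite C" "Y \<in> matrices B C"
    and "\<And>w. w \<in> free_mod C \<Longrightarrow> mat_vec B X (mat_vec C Y w) = 0"
  shows "mat_mult B X Y = 0"
proof (intro ext)
  fix p r
  show "mat_mult B X Y p r = 0 p r"
  proof (cases "r \<in> C")
    case True
    have "mat_mult B X Y p r = mat_vec B X (\<lambda>q. Y q r) p"
      by (simp add: mat_mult_def mat_vec_def)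
    also have "(\<lambda>q. Y q r) = mat_vec C Y (unit_vec r)"
      by (rule mat_vec_unit_vec[OF assms(1) True, symmetric])
    finally show ?thesis using assms(3)[OF unit_vec_free[OF True]] by simp
  next
    case False
    with assms(2) show ?thesis by (simp add: mat_mult_def matrices_def)
  qed
qed

text \<open>Free modules are projective: a preimage is chosen for each column separately.\<close>

lemma solve_columns:
  assumes "X \<in> matrices P A"
    and "\<And>a. a \<in> A \<Longrightarrow> (\<lambda>p. X p a) \<in> mat_vec B M ` free_mod B"
  shows "\<exists>Y\<in>matrices B A. mat_mult B M Y = X"
proof -
  have "\<forall>a\<in>A. \<exists>u\<in>free_mod B. mat_vec B M u = (\<lambda>p. X p a)"
    using assms(2) by (metis image_iff)
  then obtain y where y: "\<And>a. a \<in> A \<Longrightarrow> y a \<in> free_mod B"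
    "\<And>a. a \<in> A \<Longrightarrow> mat_vec B M (y a) = (\<lambda>p. X p a)"
    by metis
  let ?Y = "\<lambda>b a. if a \<in> A then y a b else 0"
  have "mat_mult B M ?Y = X"
  proof (intro ext)
    fix p a
    show "mat_mult B M ?Y p a = X p a"
    proof (cases "a \<in> A")
      case True
      with y(2)[OF this] show ?thesis by (simp add: mat_mult_def mat_vec_def fun_eq_iff)
    next
      case False
      with assms(1) show ?thesis by (auto simp: mat_mult_def matrices_def)
    qed
  qed
  moreover have "?Y \<in> matrices B A"
    using y(1) by (auto simp: matrices_def free_mod_def)
  ultimately show ?thesis by blast
qed

section \<open>Chain maps and homotopies between exact complexes\<close>

definition complex_on :: "(nat \<Rightarrow> nat set) \<Rightarrow> (nat \<Rightarrow> nat \<Rightarrow> nat \<Rightarrow> 'r::comm_ring_1) \<Rightarrow> bool" where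
  "complex_on L M \<longleftrightarrow> (\<forall>i. finite (L i) \<and> M i \<in> matrices (L i) (L (Suc i)) \<and>
     mat_mult (L (Suc i)) (M i) (M (Suc i)) = 0)"

text \<open>Exactness starts at level 1, so this is a free resolution of the cokernel of
  \<open>M 0\<close>.\<close>

definition exact_on :: "(nat \<Rightarrow> nat set) \<Rightarrow> (nat \<Rightarrow> nat \<Rightarrow> nat \<Rightarrow> 'r::comm_ring_1) \<Rightarrow> bool" where
  "exact_on L M \<longleftrightarrow> complex_on L M \<and>
     (\<forall>i. \<forall>u\<in>free_mod (L (Suc i)). mat_vec (L (Suc i)) (M i) u = 0 \<longrightarrow>
        u \<in> mat_vec (L (Suc (Suc i))) (M (Suc i)) ` free_mod (L (Suc (Suc i))))"

text \<open>The single lifting step behind both the chain map and the homotopy.\<close>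

lemma exact_on_lift:
  assumes "exact_on L M" "X \<in> matrices (L (Suc i)) A" "mat_mult (L (Suc i)) (M i) X = 0"
  shows "\<exists>Y\<in>matrices (L (Suc (Suc i))) A. mat_mult (L (Suc (Suc i))) (M (Suc i)) Y = X"
proof (rule solve_columns[OF assms(2)])
  fix a
  have "(\<lambda>p. X p a) \<in> free_mod (L (Suc i))"
    using assms(2) by (auto simp: matrices_def free_mod_def)
  moreover have "mat_vec (L (Suc i)) (M i) (\<lambda>p. X p a) = 0"
    using assms(3) by (simp add: mat_vec_def mat_mult_def fun_eq_iff)
  ultimately show "(\<lambda>p. X p a) \<in> mat_vec (L (Suc (Suc i))) (M (Suc i)) ` free_mod (L (Suc (Suc i)))"
    using assms(1) by (simp add: exact_on_def)
qed

text \<open>Comparison theorem over the identity of level 0. The first lift comes from the inclusion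
  of images \<open>img\<close>, all later ones from exactness of the target.\<close>

lemma chain_map_exists:
  assumes G: "complex_on L M" and F: "exact_on L' M'"
    and zero: "L 0 = {0}" "L' 0 = {0}"
    and img: "mat_vec (L 1) (M 0) ` free_mod (L 1) \<subseteq> mat_vec (L' 1) (M' 0) ` free_mod (L' 1)"
  shows "\<exists>f. f 0 = unit_mat {0} \<and> (\<forall>i. f i \<in> matrices (L' i) (L i)) \<and>
    (\<forall>i. mat_mult (L' (Suc i)) (M' i) (f (Suc i)) = mat_mult (L i) (f i) (M i))"
proof -
  \<comment> \<open>Extending \<open>f'\<close> uses its commutation with the previous map, which is
    no longer visible at the next index. Hence the invariant itself contains extendability.\<close>
  define P where "P = (\<lambda>i f. f \<in> matrices (L' i) (L i) \<and> (i = 0 \<longrightarrow> f = unit_mat {0}) \<and>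
    (\<exists>f'\<in>matrices (L' (Suc i)) (L (Suc i)). mat_mult (L' (Suc i)) (M' i) f' = mat_mult (L i) f (M i)))"
  have GM: "M i \<in> matrices (L i) (L (Suc i))" "finite (L i)"
    "mat_mult (L (Suc i)) (M i) (M (Suc i)) = 0" for i
    using G by (auto simp: complex_on_def)
  have "\<exists>f. \<forall>i. P i (f i) \<and> mat_mult (L' (Suc i)) (M' i) (f (Suc i)) = mat_mult (L i) (f i) (M i)"
  proof (rule dependent_nat_choice)
    have "\<exists>f'\<in>matrices (L' 1) (L 1). mat_mult (L' 1) (M' 0) f' = M 0"
    proof (rule solve_columns)
      show "M 0 \<in> matrices (L 0) (L 1)" using GM(1)[of 0] by simp
      fix a assume a: "a \<in> L 1"
      have "mat_vec (L 1) (M 0) (unit_vec a) = (\<lambda>p. M 0 p a)"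
        using a GM(2)[of 1] by (rule_tac mat_vec_unit_vec)
      moreover have "unit_vec a \<in> free_mod (L 1)"
        using a by (rule unit_vec_free)
      ultimately have "(\<lambda>p. M 0 p a) \<in> mat_vec (L 1) (M 0) ` free_mod (L 1)"
        by (rule image_eqI[OF sym])
      then show "(\<lambda>p. M 0 p a) \<in> mat_vec (L' 1) (M' 0) ` free_mod (L' 1)"
        using img by blast
    qed
    moreover have "mat_mult (L 0) (unit_mat {0}) (M 0) = M 0"
      using mat_mult_unit_mat(2)[OF GM(2) GM(1), of 0] zero(1) by simp
    ultimately have "P 0 (unit_mat {0})"
      unfolding P_def using zero unit_mat_matrices[of "{0}"] by (simp del: One_nat_def add: One_nat_def[symmetric])
    then show "\<exists>f. P 0 f" by blast
  next
    fix f i assume "P i f"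
    then obtain f' where f': "f' \<in> matrices (L' (Suc i)) (L (Suc i))"
      "mat_mult (L' (Suc i)) (M' i) f' = mat_mult (L i) f (M i)"
      by (auto simp: P_def)
    have "\<exists>f''\<in>matrices (L' (Suc (Suc i))) (L (Suc (Suc i))).
      mat_mult (L' (Suc (Suc i))) (M' (Suc i)) f'' = mat_mult (L (Suc i)) f' (M (Suc i))"
    proof (rule exact_on_lift[OF F])
      show "mat_mult (L (Suc i)) f' (M (Suc i)) \<in> matrices (L' (Suc i)) (L (Suc (Suc i)))"
        using f'(1) GM by (intro mat_mult_matrices)
      show "mat_mult (L' (Suc i)) (M' i) (mat_mult (L (Suc i)) f' (M (Suc i))) = 0"
        using f'(2) GM(3)[of i] by (metis mat_mult_assoc mat_mult_zero(1))
    qed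
    with f' have "P (Suc i) f'" unfolding P_def by blast
    with f'(2) show "\<exists>g. P (Suc i) g \<and> mat_mult (L' (Suc i)) (M' i) g = mat_mult (L i) f (M i)"
      by blast
  qed
  then obtain f where "\<forall>i. P i (f i) \<and> mat_mult (L' (Suc i)) (M' i) (f (Suc i)) = mat_mult (L i) (f i) (M i)"
    by blast
  then show ?thesis by (intro exI[of _ f]) (auto simp: P_def)
qed

text \<open>Each index gets its own pair of consecutive homotopy maps. The induction hands on
  \<open>h'\<close> as the next \<open>h\<close>; it starts with \<open>h = 0\<close> because
  \<open>f\<close> is the identity at level 0.\<close>

lemma chain_homotopy_exists:
  assumes G: "exact_on L M"
    and f0: "f 0 = unit_mat (L 0)" and f: "\<And>i. f i \<in> matrices (L i) (L i)"
    and comm: "\<And>i. mat_mult (L (Suc i)) (M i) (f (Suc i)) = mat_mult (L i) (f i) (M i)"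
  shows "\<exists>h h'. h \<in> matrices (L (Suc i)) (L i) \<and> h' \<in> matrices (L (Suc (Suc i))) (L (Suc i)) \<and>
    (i = 0 \<longrightarrow> h = 0) \<and>
    f (Suc i) - unit_mat (L (Suc i)) = mat_mult (L (Suc (Suc i))) (M (Suc i)) h' + mat_mult (L i) h (M i)"
proof (induction i)
  have GM: "M i \<in> matrices (L i) (L (Suc i))" "finite (L i)"
    "mat_mult (L (Suc i)) (M i) (M (Suc i)) = 0" for i
    using G by (auto simp: exact_on_def complex_on_def)
  have unit: "mat_mult (L (Suc i)) (M i) (unit_mat (L (Suc i))) = M i"
    "mat_mult (L i) (unit_mat (L i)) (M i) = M i" for i
    using GM mat_mult_unit_mat by blast+
  {
    case 0
    have "mat_mult (L (Suc 0)) (M 0) (f (Suc 0) - unit_mat (L (Suc 0))) = 0"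
      by (simp add: mat_mult_diff comm f0 unit)
    from exact_on_lift[OF G matrices_diff[OF f unit_mat_matrices] this]
    obtain h' where h': "h' \<in> matrices (L (Suc (Suc 0))) (L (Suc 0))"
      "mat_mult (L (Suc (Suc 0))) (M (Suc 0)) h' = f (Suc 0) - unit_mat (L (Suc 0))" by blast
    then have "f (Suc 0) - unit_mat (L (Suc 0)) =
        mat_mult (L (Suc (Suc 0))) (M (Suc 0)) h' + mat_mult (L 0) 0 (M 0)"
      by (simp only: mat_mult_zero add_0_right)
    with h'(1) matrices_zero show ?case by blast
  next
    case (Suc i)
    then obtain h h' where h: "h \<in> matrices (L (Suc i)) (L i)" "h' \<in> matrices (L (Suc (Suc i))) (L (Suc i))"
      and eq: "f (Suc i) - unit_mat (L (Suc i)) = mat_mult (L (Suc (Suc i))) (M (Suc i)) h' + mat_mult (L i) h (M i)"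
      by blast
    \<comment> \<open>The part of \<open>f - 1\<close> not yet explained by \<open>h'\<close>; it is
      a cycle, so exactness provides the next homotopy map.\<close>
    let ?x = "f (Suc (Suc i)) - unit_mat (L (Suc (Suc i))) - mat_mult (L (Suc i)) h' (M (Suc i))"
    have "mat_mult (L (Suc (Suc i))) (M (Suc i)) ?x =
      mat_mult (L (Suc i)) (f (Suc i) - unit_mat (L (Suc i))) (M (Suc i))
      - mat_mult (L (Suc i)) (mat_mult (L (Suc (Suc i))) (M (Suc i)) h') (M (Suc i))"
      by (simp add: mat_mult_diff comm unit mat_mult_assoc)
    also have "\<dots> = mat_mult (L (Suc i)) (mat_mult (L i) h (M i)) (M (Suc i))"
      by (simp add: eq mat_mult_add)
    also have "\<dots> = 0"
      by (simp add: mat_mult_assoc[symmetric] GM)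
    finally have 0: "mat_mult (L (Suc (Suc i))) (M (Suc i)) ?x = 0" .
    have "?x \<in> matrices (L (Suc (Suc i))) (L (Suc (Suc i)))"
      using f h GM by (intro matrices_diff mat_mult_matrices unit_mat_matrices)
    from exact_on_lift[OF G this 0] obtain h'' where
      "h'' \<in> matrices (L (Suc (Suc (Suc i)))) (L (Suc (Suc i)))"
      "mat_mult (L (Suc (Suc (Suc i)))) (M (Suc (Suc i))) h'' = ?x" by blast
    then show ?case
      using h by (rule_tac exI[of _ h'], rule_tac exI[of _ h'']) simp
  }
qed

section \<open>Comparing ranks over the field\<close>

interpretation fun_space: vector_space "\<lambda>(a::'k::field) (u::nat \<Rightarrow> 'k) p. a * u p"
  by unfold_locales (simp_all add: fun_eq_iff algebra_simps)

lemma sum_fun_apply: "(\<Sum>a\<in>A. f a) x = (\<Sum>a\<in>A. f a x)" for f :: "'a \<Rightarrow> 'b \<Rightarrow> 'c::comm_monoid_add"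
  by (induction A rule: infinite_finite_induct) auto

lemma free_mod_subset_span:
  assumes "finite A"
  shows "free_mod A \<subseteq> fun_space.span (unit_vec ` A)"
proof
  fix u :: "nat \<Rightarrow> 'k::field" assume u: "u \<in> free_mod A"
  have "u = (\<Sum>a\<in>A. (\<lambda>p. u a * unit_vec a p))"
  proof
    fix p
    have "(\<Sum>a\<in>A. u a * unit_vec a p) = (\<Sum>a\<in>A. if p = a then u p else 0)"
      by (intro sum.cong) (auto simp: unit_vec_def)
    then show "u p = (\<Sum>a\<in>A. (\<lambda>p. u a * unit_vec a p)) p"
      using assms u by (auto simp: sum_fun_apply free_mod_def)
  qed
  also have "\<dots> \<in> fun_space.span (unit_vec ` A)"
    by (intro fun_space.span_sum fun_space.span_scale fun_space.span_base) auto
  finally show "u \<in> fun_space.span (unit_vec ` A)" .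
qed

text \<open>A left inverse makes the columns of \<open>Y\<close> independent, and they lie in the
  span of the unit vectors of \<open>B\<close>.\<close>

lemma card_le_of_left_inverse:
  fixes X Y :: "nat \<Rightarrow> nat \<Rightarrow> 'k::field"
  assumes fin: "finite A" "finite B" and Y: "Y \<in> matrices B A" and inv: "mat_mult B X Y = unit_mat A"
  shows "card A \<le> card B"
proof -
  define col where "col = (\<lambda>a b. Y b a)"
  have X_col: "mat_vec B X (col a) = (\<lambda>p. unit_mat A p a)" for a
    using inv by (simp add: mat_vec_def col_def mat_mult_def fun_eq_iff)
  \<comment> \<open>Independence is a property of the set of columns, so distinct indices must first
    be shown to give distinct columns.\<close>
  have inj: "inj_on col A"
  proof
    fix a a' assume a: "a \<in> A" and eq: "col a = col a'"
    have "unit_mat A a a = (unit_mat A a a' :: 'k)"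
      using X_col[of a] X_col[of a'] unfolding eq by metis
    with a show "a = a'" by (simp add: unit_mat_def split: if_splits)
  qed
  have indep: "fun_space.independent (col ` A)"
    unfolding fun_space.dependent_finite[OF finite_imageI[OF fin(1)]]
  proof safe
    fix u a assume a: "a \<in> A" "u (col a) \<noteq> 0"
      and 0: "(\<Sum>v\<in>col ` A. (\<lambda>p. u v * v p)) = 0"
    \<comment> \<open>Applying \<open>X\<close> to a linear relation between the columns returns its
      coefficients.\<close>
    have "0 = mat_vec B X (\<Sum>v\<in>col ` A. (\<lambda>p. u v * v p)) a"
      by (simp add: 0)
    also have "\<dots> = (\<Sum>b\<in>B. X a b * (\<Sum>a'\<in>A. u (col a') * col a' b))"
      by (simp add: mat_vec_def sum_fun_apply sum.reindex[OF inj])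
    also have "\<dots> = (\<Sum>a'\<in>A. u (col a') * (\<Sum>b\<in>B. X a b * col a' b))"
      unfolding sum_distrib_left by (subst sum.swap) (simp add: algebra_simps)
    also have "\<dots> = (\<Sum>a'\<in>A. u (col a') * unit_mat A a a')"
      using X_col by (simp add: mat_vec_def fun_eq_iff)
    also have "\<dots> = (\<Sum>a'\<in>A. if a = a' then u (col a) else 0)"
      by (intro sum.cong) (auto simp: unit_mat_def)
    also have "\<dots> = u (col a)"
      using fin a by simp
    finally show False using a by simp
  qed
  have "col ` A \<subseteq> free_mod B"
    using Y by (auto simp: col_def free_mod_def matrices_def)
  then have "col ` A \<subseteq> fun_space.span (unit_vec ` B)"
    using free_mod_subset_span[OF fin(2)] by blast
  from fun_space.independent_span_bound[OF _ indep this] fin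
  have "card (col ` A) \<le> card ((unit_vec :: nat \<Rightarrow> nat \<Rightarrow> 'k) ` B)"
    by simp
  also have "\<dots> \<le> card B" using fin by (rule_tac card_image_le)
  finally show ?thesis using card_image[OF inj] by simp
qed

text \<open>The chain map from a minimal complex to itself through another resolution is homotopic to the
  identity, hence equal to it modulo the kernel of \<open>\<epsilon>\<close>.\<close>

lemma minimal_rank_le:
  fixes M M' :: "nat \<Rightarrow> nat \<Rightarrow> nat \<Rightarrow> 'r::comm_ring_1" and \<epsilon> :: "'r \<Rightarrow> 'k::field"
  assumes G: "exact_on L M" and F: "exact_on L' M'"
    and zero: "L 0 = {0}" "L' 0 = {0}"
    and img: "mat_vec (L 1) (M 0) ` free_mod (L 1) = mat_vec (L' 1) (M' 0) ` free_mod (L' 1)"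
    and hom: "\<epsilon> 0 = 0" "\<epsilon> 1 = 1" "\<And>x y. \<epsilon> (x + y) = \<epsilon> x + \<epsilon> y" "\<And>x y. \<epsilon> (x * y) = \<epsilon> x * \<epsilon> y"
    and minimal: "\<And>i p q. \<epsilon> (M (Suc i) p q) = 0"
  shows "card (L (Suc i)) \<le> card (L' (Suc i))"
proof -
  have cG: "complex_on L M" and cF: "complex_on L' M'" using G F by (auto simp: exact_on_def)
  obtain f where f: "f 0 = unit_mat {0}" "\<And>i. f i \<in> matrices (L' i) (L i)"
    "\<And>i. mat_mult (L' (Suc i)) (M' i) (f (Suc i)) = mat_mult (L i) (f i) (M i)"
    using chain_map_exists[OF cG F zero] img by blast
  obtain g where g: "g 0 = unit_mat {0}" "\<And>i. g i \<in> matrices (L i) (L' i)"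
    "\<And>i. mat_mult (L (Suc i)) (M i) (g (Suc i)) = mat_mult (L' i) (g i) (M' i)"
    using chain_map_exists[OF cF G zero(2,1)] img by blast
  define t where "t = (\<lambda>i. mat_mult (L' i) (g i) (f i))"
  have "\<exists>h h'. h \<in> matrices (L (Suc i)) (L i) \<and> h' \<in> matrices (L (Suc (Suc i))) (L (Suc i)) \<and>
    (i = 0 \<longrightarrow> h = 0) \<and>
    t (Suc i) - unit_mat (L (Suc i)) = mat_mult (L (Suc (Suc i))) (M (Suc i)) h' + mat_mult (L i) h (M i)"
  proof (rule chain_homotopy_exists[OF G])
    show "t 0 = unit_mat (L 0)"
      using f(1) g(1) zero mat_mult_unit_mat(2)[of "{0}"] unit_mat_matrices[of "{0}"]
      by (simp add: t_def)
    show "t i \<in> matrices (L i) (L i)" for i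
      using f g by (auto simp: t_def intro: mat_mult_matrices)
    show "mat_mult (L (Suc i)) (M i) (t (Suc i)) = mat_mult (L i) (t i) (M i)" for i
      by (metis t_def f(3) g(3) mat_mult_assoc)
  qed
  then obtain h h' where h: "i = 0 \<longrightarrow> h = 0" and
    eq: "t (Suc i) - unit_mat (L (Suc i)) = mat_mult (L (Suc (Suc i))) (M (Suc i)) h' + mat_mult (L i) h (M i)"
    by blast
  have \<epsilon>_sum: "\<epsilon> (\<Sum>a\<in>A. k a) = (\<Sum>a\<in>A. \<epsilon> (k a))" for A :: "nat set" and k
    by (induction A rule: infinite_finite_induct) (auto simp: hom)
  have "\<epsilon> (mat_mult (L (Suc (Suc i))) (M (Suc i)) h' p q) = 0" for p q
    by (simp add: mat_mult_def \<epsilon>_sum hom minimal)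
  \<comment> \<open>\<open>minimal\<close> says nothing about \<open>M 0\<close>; for
    \<open>i = 0\<close> the term vanishes because \<open>h = 0\<close>.\<close>
  moreover have "\<epsilon> (mat_mult (L i) h (M i) p q) = 0" for p q
    using h by (cases i) (simp_all add: mat_mult_def \<epsilon>_sum hom minimal)
  ultimately have "\<epsilon> ((t (Suc i) - unit_mat (L (Suc i))) p q) = 0" for p q
    unfolding eq by (simp add: hom)
  then have \<epsilon>_t: "\<epsilon> (t (Suc i) p q) = \<epsilon> (unit_mat (L (Suc i)) p q)" for p q
    using hom(3)[of "(t (Suc i) - unit_mat (L (Suc i))) p q" "unit_mat (L (Suc i)) p q"] by simp
  have "mat_mult (L' (Suc i)) (\<lambda>p q. \<epsilon> (g (Suc i) p q)) (\<lambda>p q. \<epsilon> (f (Suc i) p q)) = unit_mat (L (Suc i))"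
  proof (intro ext)
    fix p q
    show "mat_mult (L' (Suc i)) (\<lambda>p q. \<epsilon> (g (Suc i) p q)) (\<lambda>p q. \<epsilon> (f (Suc i) p q)) p q
        = unit_mat (L (Suc i)) p q"
      using \<epsilon>_t[of p q] by (simp add: t_def mat_mult_def \<epsilon>_sum hom unit_mat_def split: if_splits)
  qed
  moreover have "(\<lambda>p q. \<epsilon> (f (Suc i) p q)) \<in> matrices (L' (Suc i)) (L (Suc i))"
    using f(2)[of "Suc i"] hom(1) by (auto simp: matrices_def)
  ultimately show ?thesis
    using cG cF by (intro card_le_of_left_inverse) (auto simp: complex_on_def)
qed

section \<open>Homology of subquotient complexes\<close>

text \<open>The differential compressed to the basis elements in \<open>C\<close>: components that
  leave the region are dropped. For a subquotient complex this is the induced differential.\<close>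

definition region_map ::
  "(nat \<Rightarrow> nat \<Rightarrow> nat \<Rightarrow> 'k::field) \<Rightarrow> (nat \<Rightarrow> nat set) \<Rightarrow> nat \<Rightarrow> (nat \<Rightarrow> 'k) \<Rightarrow> nat \<Rightarrow> 'k" where
  "region_map c C i u = (\<lambda>p. if p \<in> C i then mat_vec (C (Suc i)) (c i) u p else 0)"

text \<open>At level 0 every vector of the region is a cycle, so acyclicity includes surjectivity
  onto level 0.\<close>

definition region_cycle ::
  "(nat \<Rightarrow> nat \<Rightarrow> nat \<Rightarrow> 'k::field) \<Rightarrow> (nat \<Rightarrow> nat set) \<Rightarrow> nat \<Rightarrow> (nat \<Rightarrow> 'k) \<Rightarrow> bool" where
  "region_cycle c C i u \<longleftrightarrow> u \<in> free_mod (C i) \<and> (\<forall>j. i = Suc j \<longrightarrow> region_map c C j u = 0)"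

definition region_acyclic :: "(nat \<Rightarrow> nat \<Rightarrow> nat \<Rightarrow> 'k::field) \<Rightarrow> (nat \<Rightarrow> nat set) \<Rightarrow> bool" where
  "region_acyclic c C \<longleftrightarrow>
     (\<forall>i u. region_cycle c C i u \<longrightarrow> u \<in> region_map c C i ` free_mod (C (Suc i)))"

definition region_homology :: "(nat \<Rightarrow> nat \<Rightarrow> nat \<Rightarrow> 'k::field) \<Rightarrow> (nat \<Rightarrow> nat set) \<Rightarrow> nat \<Rightarrow> bool" where
  "region_homology c C i \<longleftrightarrow>
     (\<exists>u. region_cycle c C i u \<and> u \<notin> region_map c C i ` free_mod (C (Suc i)))"

definition restrict_vec :: "nat set \<Rightarrow> (nat \<Rightarrow> 'k::field) \<Rightarrow> nat \<Rightarrow> 'k" where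
  "restrict_vec A u = (\<lambda>p. if p \<in> A then u p else 0)"

lemma restrict_vec_free [simp]: "restrict_vec A u \<in> free_mod A"
  by (simp add: restrict_vec_def free_mod_def)

lemma restrict_vec_diff: "restrict_vec A (u - v) = restrict_vec A u - restrict_vec A v"
  by (auto simp: restrict_vec_def fun_eq_iff)

lemma restrict_vec_id: "u \<in> free_mod A \<Longrightarrow> restrict_vec A u = u"
  by (auto simp: restrict_vec_def free_mod_def fun_eq_iff)

lemma region_map_free [simp]: "region_map c C i u \<in> free_mod (C i)"
  by (simp add: region_map_def free_mod_def)

lemma region_map_diff: "region_map c C i (u - v) = region_map c C i u - region_map c C i v"
  by (auto simp: region_map_def mat_vec_diff fun_eq_iff)

text \<open>A short exact sequence of complexes with compatible bases: by \<open>closed\<close>,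
  \<open>S\<close> is a subcomplex of \<open>C\<close>, and \<open>T\<close> is a basis of the
  quotient.\<close>

locale subregion =
  fixes c :: "nat \<Rightarrow> nat \<Rightarrow> nat \<Rightarrow> 'k::field" and C S T :: "nat \<Rightarrow> nat set"
  assumes finite_C: "finite (C i)"
    and S_subset: "S i \<subseteq> C i" and T_def: "T i = C i - S i"
    and closed: "p \<in> C i \<Longrightarrow> q \<in> S (Suc i) \<Longrightarrow> c i p q \<noteq> 0 \<Longrightarrow> p \<in> S i"
    and square_zero: "region_map c C i (region_map c C (Suc i) u) = 0"
begin

lemma region_map_S:
  assumes "u \<in> free_mod (S (Suc i))"
  shows "region_map c C i u = region_map c S i u"
proof
  fix p
  have "mat_vec (C (Suc i)) (c i) u p = mat_vec (S (Suc i)) (c i) u p"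
    unfolding mat_vec_def using assms
    by (intro sum.mono_neutral_right finite_C S_subset) (auto simp: free_mod_def)
  moreover have "mat_vec (S (Suc i)) (c i) u p = 0" if "p \<in> C i" "p \<notin> S i"
    unfolding mat_vec_def using that closed by (intro sum.neutral) fastforce
  ultimately show "region_map c C i u p = region_map c S i u p"
    using S_subset[of i] by (auto simp: region_map_def)
qed

text \<open>Restriction to \<open>T\<close> is the quotient map; it is a chain map because, by
  \<open>closed\<close>, terms from \<open>S\<close> never reach \<open>T\<close>.\<close>

lemma region_map_T:
  assumes "w \<in> free_mod (C (Suc i))"
  shows "region_map c T i (restrict_vec (T (Suc i)) w) = restrict_vec (T i) (region_map c C i w)"
proof
  fix p
  show "region_map c T i (restrict_vec (T (Suc i)) w) p = restrict_vec (T i) (region_map c C i w) p"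
  proof (cases "p \<in> T i")
    case True
    have "mat_vec (T (Suc i)) (c i) (restrict_vec (T (Suc i)) w) p = mat_vec (C (Suc i)) (c i) w p"
      unfolding mat_vec_def
      by (rule sum.mono_neutral_cong_left)
        (use True closed in \<open>auto simp: finite_C restrict_vec_def T_def\<close>)
    with True show ?thesis by (simp add: region_map_def restrict_vec_def T_def)
  next
    case False
    then show ?thesis by (simp add: region_map_def restrict_vec_def)
  qed
qed

lemma restrict_T_zero_iff: "u \<in> free_mod (C i) \<Longrightarrow> restrict_vec (T i) u = 0 \<longleftrightarrow> u \<in> free_mod (S i)"
  by (auto simp: restrict_vec_def T_def free_mod_def fun_eq_iff)

lemma S_free: "u \<in> free_mod (S i) \<Longrightarrow> u \<in> free_mod (C i)"
  using S_subset free_mod_mono by blast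

lemma T_free: "u \<in> free_mod (T i) \<Longrightarrow> u \<in> free_mod (C i)"
  by (rule free_mod_mono) (auto simp: T_def)

text \<open>The boundary in \<open>C\<close> of a cycle \<open>u\<close> of \<open>T\<close> is a
  cycle of \<open>S\<close>, hence the boundary of some \<open>b\<close> in \<open>S\<close>. Then
  \<open>u - b\<close> is a cycle of \<open>C\<close> with the same image in \<open>T\<close>, and a
  preimage of it under the differential is projected to \<open>T\<close>.\<close>

lemma quotient_acyclic:
  assumes C: "region_acyclic c C" and S: "region_acyclic c S"
  shows "region_acyclic c T"
  unfolding region_acyclic_def
proof safe
  fix i u assume u: "region_cycle c T i u"
  then have uT: "u \<in> free_mod (T i)" by (simp add: region_cycle_def)
  have "\<exists>b\<in>free_mod (S i). region_cycle c C i (u - b)"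
  proof (cases i)
    case 0
    with uT show ?thesis by (intro bexI[of _ 0]) (auto simp: region_cycle_def T_free)
  next
    case (Suc j)
    define a where "a = region_map c C j u"
    have "restrict_vec (T j) a = region_map c T j u"
      using region_map_T[of u j] uT Suc by (simp add: a_def T_free restrict_vec_id)
    also have "\<dots> = 0" using u Suc by (simp add: region_cycle_def)
    finally have aS: "a \<in> free_mod (S j)"
      using restrict_T_zero_iff[of a j] by (simp add: a_def)
    have "region_cycle c S j a"
      unfolding region_cycle_def
    proof safe
      fix k assume k: "j = Suc k"
      show "region_map c S k a = 0"
        using region_map_S[of a k] aS square_zero[of k u] k by (simp add: a_def)
    qed (rule aS)
    then obtain b where b: "b \<in> free_mod (S i)" "a = region_map c S j b"
      using S Suc unfolding region_acyclic_def by blast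
    then have "region_map c C j (u - b) = 0"
      using region_map_S[of b j] Suc by (simp add: region_map_diff a_def)
    moreover have "u - b \<in> free_mod (C i)"
      using uT b(1) by (intro free_mod_diff T_free S_free)
    ultimately show ?thesis using b(1) Suc by (auto simp: region_cycle_def)
  qed
  then obtain b where b: "b \<in> free_mod (S i)" "region_cycle c C i (u - b)" by blast
  then obtain w where w: "w \<in> free_mod (C (Suc i))" "u - b = region_map c C i w"
    using C unfolding region_acyclic_def by blast
  have "restrict_vec (T i) b = 0"
    using restrict_T_zero_iff b(1) S_free by blast
  then have "restrict_vec (T i) (u - b) = u"
    using uT by (simp add: restrict_vec_diff restrict_vec_id)
  then have "u = region_map c T i (restrict_vec (T (Suc i)) w)"
    using region_map_T[OF w(1)] w(2) by simp
  then show "u \<in> region_map c T i ` free_mod (T (Suc i))" by auto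
qed

text \<open>The connecting map read backwards: a cycle \<open>z\<close> of \<open>S\<close> bounds
  some \<open>w\<close> in \<open>C\<close>, and the image of \<open>w\<close> in \<open>T\<close>
  is a cycle one level higher.\<close>

lemma quotient_homology:
  assumes C: "region_acyclic c C" and S: "region_homology c S s"
  shows "region_homology c T (Suc s)"
proof -
  obtain z where z: "region_cycle c S s z" "z \<notin> region_map c S s ` free_mod (S (Suc s))"
    using S by (auto simp: region_homology_def)
  then have zS: "z \<in> free_mod (S s)" by (simp add: region_cycle_def)
  have "region_cycle c C s z"
    unfolding region_cycle_def
  proof safe
    fix j assume "s = Suc j"
    then show "region_map c C j z = 0"
      using z(1) zS region_map_S[of z j] by (simp add: region_cycle_def)
  qed (use zS S_free in blast)
  then obtain w where w: "w \<in> free_mod (C (Suc s))" "z = region_map c C s w"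
    using C unfolding region_acyclic_def by blast
  define w' where "w' = restrict_vec (T (Suc s)) w"
  have "region_map c T s w' = restrict_vec (T s) z"
    using region_map_T[OF w(1)] w(2) by (simp add: w'_def)
  also have "\<dots> = 0" using restrict_T_zero_iff zS S_free by blast
  finally have "region_cycle c T (Suc s) w'"
    by (simp add: region_cycle_def w'_def)
  moreover have "w' \<notin> region_map c T (Suc s) ` free_mod (T (Suc (Suc s)))"
  proof
    assume "w' \<in> region_map c T (Suc s) ` free_mod (T (Suc (Suc s)))"
    then obtain y where y: "y \<in> free_mod (T (Suc (Suc s)))" "w' = region_map c T (Suc s) y" by blast
    \<comment> \<open>If the image of \<open>w\<close> were the boundary of \<open>y\<close> in
      \<open>T\<close>, then \<open>x\<close> would lie in \<open>S\<close> and still have boundary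
      \<open>z\<close>.\<close>
    define x where "x = w - region_map c C (Suc s) y"
    have "restrict_vec (T (Suc s)) (region_map c C (Suc s) y) = w'"
      using region_map_T[of y "Suc s"] y by (simp add: T_free restrict_vec_id)
    then have "restrict_vec (T (Suc s)) x = 0"
      by (simp add: x_def restrict_vec_diff w'_def)
    moreover have "x \<in> free_mod (C (Suc s))"
      unfolding x_def using w(1) by (intro free_mod_diff region_map_free)
    ultimately have xS: "x \<in> free_mod (S (Suc s))" using restrict_T_zero_iff by blast
    have "region_map c C s x = z"
      using w(2) by (simp add: x_def region_map_diff square_zero)
    with xS region_map_S[OF xS] z(2) show False by auto
  qed
  ultimately show ?thesis by (auto simp: region_homology_def)
qed

end

text \<open>A squarefree multigraded resolution of the quotient by the edge ideal: the basis element \<open>q\<close> of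
  level \<open>i\<close> has degree \<open>D i q\<close>, and the entries of the differentials are the scalars \<open>c i p q\<close> times the
  monomials of degree \<open>D (Suc i) q - D i p\<close>. The strand in degree \<open>W\<close> is the complex of vector spaces on
  the basis elements of degree at most \<open>W\<close>. Level \<open>0\<close> is the ring, so level \<open>Suc i\<close> is the module
  \<open>F\<^sub>i\<close> of a resolution of the ideal.\<close>

locale squarefree_resolution =
  fixes E :: "'v::finite set set" and B :: "nat \<Rightarrow> nat set" and D :: "nat \<Rightarrow> nat \<Rightarrow> 'v set"
    and c :: "nat \<Rightarrow> nat \<Rightarrow> nat \<Rightarrow> 'k::field"
  assumes complex: "complex_on B c"
    and B_0: "B 0 = {0}" and D_0: "D 0 0 = {}"
    and c_degree: "c i p q \<noteq> 0 \<Longrightarrow> D i p \<subset> D (Suc i) q"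
    and D_1: "q \<in> B 1 \<Longrightarrow> \<exists>e\<in>E. e \<subseteq> D 1 q"
    and exact_0: "e \<in> E \<Longrightarrow> e \<subseteq> W \<Longrightarrow>
      unit_vec 0 \<in> mat_vec (B 1) (c 0) ` free_mod {q \<in> B 1. D 1 q \<subseteq> W}"
    and exact_Suc: "u \<in> free_mod {q \<in> B (Suc i). D (Suc i) q \<subseteq> W} \<Longrightarrow>
      mat_vec (B (Suc i)) (c i) u = 0 \<Longrightarrow>
      u \<in> mat_vec (B (Suc (Suc i))) (c (Suc i)) ` free_mod {q \<in> B (Suc (Suc i)). D (Suc (Suc i)) q \<subseteq> W}"
    and length: "i > card (UNIV :: 'v set) \<Longrightarrow> B i = {}"
begin

lemma finite_B: "finite (B i)"
  using complex by (simp add: complex_on_def)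

lemma c_outside: "p \<notin> B i \<or> q \<notin> B (Suc i) \<Longrightarrow> c i p q = 0"
  using complex by (simp add: complex_on_def matrices_def)

lemma c_square: "mat_mult (B (Suc i)) (c i) (c (Suc i)) = 0"
  using complex by (simp add: complex_on_def)

text \<open>The subquotient of the strand of \<open>W\<close> spanned by the basis elements of degree at least \<open>U\<close>.\<close>

definition interval :: "'v set \<Rightarrow> 'v set \<Rightarrow> nat \<Rightarrow> nat set" where
  "interval U W i = {q \<in> B i. U \<subseteq> D i q \<and> D i q \<subseteq> W}"

lemma interval_eq: "interval {} W i = {q \<in> B i. D i q \<subseteq> W}"
  by (simp add: interval_def)

text \<open>By \<open>c_degree\<close> the differential never leads to a degree outside
  \<open>W\<close>; only the lower bound \<open>U\<close> cuts anything off.\<close>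

lemma region_map_interval:
  assumes "u \<in> free_mod (interval U W (Suc i))"
  shows "region_map c (interval U W) i u p =
    (if U \<subseteq> D i p then mat_vec (B (Suc i)) (c i) u p else 0)"
proof -
  have eq: "mat_vec (interval U W (Suc i)) (c i) u = mat_vec (B (Suc i)) (c i) u"
    unfolding mat_vec_def fun_eq_iff using assms finite_B
    by (intro allI sum.mono_neutral_left) (auto simp: free_mod_def interval_def)
  have "mat_vec (B (Suc i)) (c i) u p = 0" if "p \<notin> B i \<or> \<not> D i p \<subseteq> W"
    unfolding mat_vec_def
  proof (rule sum.neutral, safe)
    fix q assume "q \<in> B (Suc i)"
    show "c i p q * u q = 0"
    proof (rule ccontr)
      assume "c i p q * u q \<noteq> 0"
      then have "c i p q \<noteq> 0" "D (Suc i) q \<subseteq> W"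
        using assms by (auto simp: free_mod_def interval_def)
      with c_degree c_outside that show False by blast
    qed
  qed
  then show ?thesis by (auto simp: region_map_def eq) (auto simp: interval_def)
qed

text \<open>An intermediate element on the way down to \<open>p\<close> has a degree containing that
  of \<open>p\<close>, hence containing \<open>U\<close>. So the cut drops no term of the
  square.\<close>

lemma region_map_square: "region_map c (interval U W) i (region_map c (interval U W) (Suc i) u) = 0"
proof -
  \<comment> \<open>The values of \<open>u\<close> outside the interval have no influence;
    \<open>v\<close> satisfies the hypothesis of \<open>region_map_interval\<close>.\<close>
  define v where "v = restrict_vec (interval U W (Suc (Suc i))) u"
  have "region_map c (interval U W) (Suc i) u = region_map c (interval U W) (Suc i) v"
    by (auto simp: region_map_def mat_vec_def v_def restrict_vec_def fun_eq_iff)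
  moreover have "region_map c (interval U W) i (region_map c (interval U W) (Suc i) v) p = 0" for p
  proof (cases "U \<subseteq> D i p")
    case True
    have "mat_vec (B (Suc i)) (c i) (region_map c (interval U W) (Suc i) v) p
      = mat_vec (B (Suc i)) (c i) (mat_vec (B (Suc (Suc i))) (c (Suc i)) v) p"
      unfolding mat_vec_def[of "B (Suc i)"]
    proof (rule sum.cong[OF refl])
      fix q assume "q \<in> B (Suc i)"
      have "U \<subseteq> D (Suc i) q" if "c i p q \<noteq> 0" using c_degree[OF that] True by blast
      then show "c i p q * region_map c (interval U W) (Suc i) v q =
        c i p q * mat_vec (B (Suc (Suc i))) (c (Suc i)) v q"
        by (cases "c i p q = 0") (simp_all add: region_map_interval v_def)
    qed
    also have "\<dots> = 0"
      by (simp add: mat_vec_mat_vec c_square)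
    finally show ?thesis by (simp add: region_map_interval)
  qed (simp add: region_map_interval)
  ultimately show ?thesis by (metis zero_fun_apply ext)
qed

text \<open>The degrees up to \<open>insert x W\<close> are split by whether they contain
  \<open>x\<close>. Since the differential only leads to smaller degrees, those without
  \<open>x\<close> span a subcomplex.\<close>

lemma interval_subregion:
  assumes "x \<notin> W"
  shows "subregion c (interval U (insert x W)) (interval U W) (interval (insert x U) (insert x W))"
proof
  show "finite (interval U (insert x W) i)" for i
    using finite_B by (simp add: interval_def)
  show "region_map c (interval U (insert x W)) i (region_map c (interval U (insert x W)) (Suc i) u) = 0" for i u
    by (rule region_map_square)
  show "p \<in> interval U W i" if "p \<in> interval U (insert x W) i" "q \<in> interval U W (Suc i)" "c i p q \<noteq> 0"
    for i p q
    using that c_degree[OF that(3)] by (auto simp: interval_def)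
qed (use assms in \<open>auto simp: interval_def\<close>)

text \<open>The quotient by the edge ideal is zero in degree \<open>W\<close>, so its resolution is
  exact there, at level 0 too.\<close>

lemma interval_acyclic_of_edge:
  assumes "e \<in> E" "e \<subseteq> W"
  shows "region_acyclic c (interval {} W)"
  unfolding region_acyclic_def
proof safe
  fix i u assume u: "region_cycle c (interval {} W) i u"
  then have uf: "u \<in> free_mod (interval {} W i)" by (simp add: region_cycle_def)
  have "u \<in> mat_vec (B (Suc i)) (c i) ` free_mod (interval {} W (Suc i))"
  proof (cases i)
    case 0
    then have "u = (\<lambda>p. u 0 * unit_vec 0 p)"
      using uf B_0 by (auto simp: free_mod_def interval_def unit_vec_def fun_eq_iff)
    moreover obtain w where "w \<in> free_mod (interval {} W 1)" "unit_vec 0 = mat_vec (B 1) (c 0) w"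
      using exact_0[OF assms] by (auto simp: interval_eq)
    ultimately have "u = mat_vec (B 1) (c 0) (\<lambda>p. u 0 * w p)" "(\<lambda>p. u 0 * w p) \<in> free_mod (interval {} W 1)"
      by (auto simp: mat_vec_def sum_distrib_left algebra_simps free_mod_def)
    then show ?thesis using 0 by auto
  next
    case (Suc j)
    then have "region_map c (interval {} W) j u = 0" using u by (simp add: region_cycle_def)
    then have "mat_vec (B (Suc j)) (c j) u = 0"
      using region_map_interval[of u "{}" W j] uf Suc by (simp add: fun_eq_iff)
    then show ?thesis
      using exact_Suc[of u j W] uf Suc by (simp add: interval_eq)
  qed
  then obtain w where "w \<in> free_mod (interval {} W (Suc i))" "u = mat_vec (B (Suc i)) (c i) w" by blast
  then show "u \<in> region_map c (interval {} W) i ` free_mod (interval {} W (Suc i))"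
    using region_map_interval[of w "{}" W i] by (auto simp: fun_eq_iff intro!: image_eqI[of _ _ w])
qed

text \<open>By \<open>D_1\<close> there is nothing at level 1 that could bound the generator of
  level 0.\<close>

lemma interval_homology_of_no_edge:
  assumes "\<not> (\<exists>e\<in>E. e \<subseteq> W)"
  shows "region_homology c (interval {} W) 0"
proof -
  have "interval {} W (Suc 0) = {}"
    using assms D_1 by (fastforce simp: interval_def)
  then have "region_map c (interval {} W) 0 w = 0" for w
    by (auto simp: region_map_def mat_vec_def fun_eq_iff)
  moreover have "region_cycle c (interval {} W) 0 (unit_vec 0)"
    using B_0 D_0 by (auto simp: region_cycle_def free_mod_def interval_def unit_vec_def)
  moreover have "unit_vec 0 \<noteq> (0 :: nat \<Rightarrow> 'k)"
    by (auto simp: unit_vec_def fun_eq_iff)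
  ultimately show ?thesis unfolding region_homology_def by auto
qed

text \<open>The two claims are proved together. To add \<open>x\<close> to \<open>A\<close>, the
  interval \<open>[A, Y \<union> A]\<close> is divided out of
  \<open>[A, Y \<union> A \<union> {x}]\<close>, which is acyclic by the second claim for
  \<open>{x}\<close>; this raises the homology by one level. Acyclicity for \<open>A'\<close> comes
  from that for \<open>insert x A'\<close> and for \<open>A'\<close>.\<close>

lemma interval_induct:
  assumes disj: "Y \<inter> P = {}" and no_edge: "\<not> (\<exists>e\<in>E. e \<subseteq> Y)"
    and edge: "\<And>x. x \<in> P \<Longrightarrow> \<exists>e\<in>E. e \<subseteq> insert x Y"
    and A: "A \<subseteq> P"
  shows "region_homology c (interval A (Y \<union> A)) (card A) \<and>
    (\<forall>A'. A' \<subseteq> P \<longrightarrow> A' \<noteq> {} \<longrightarrow> A' \<inter> A = {} \<longrightarrow> region_acyclic c (interval A (Y \<union> A \<union> A')))"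
proof -
  have "finite A" by simp
  then show ?thesis using A
  proof (induction A rule: finite_induct)
    case empty
    have "region_acyclic c (interval {} (Y \<union> A'))" if A': "A' \<subseteq> P" "A' \<noteq> {}" for A'
    proof -
      obtain x where "x \<in> A'" using A' by blast
      then obtain e where "e \<in> E" "e \<subseteq> Y \<union> A'" using edge[of x] A' by blast
      then show ?thesis by (rule interval_acyclic_of_edge)
    qed
    then show ?case using interval_homology_of_no_edge[OF no_edge] by simp
  next
    case (insert x A)
    then have IH: "region_homology c (interval A (Y \<union> A)) (card A)"
      "\<And>A'. A' \<subseteq> P \<Longrightarrow> A' \<noteq> {} \<Longrightarrow> A' \<inter> A = {} \<Longrightarrow> region_acyclic c (interval A (Y \<union> A \<union> A'))"
      by auto
    have x: "x \<notin> Y" using insert.prems disj by blast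
    have "region_homology c (interval (insert x A) (Y \<union> insert x A)) (Suc (card A))"
    proof -
      interpret subregion c "interval A (insert x (Y \<union> A))" "interval A (Y \<union> A)"
        "interval (insert x A) (insert x (Y \<union> A))"
        using x insert.hyps by (intro interval_subregion) auto
      have "region_acyclic c (interval A (insert x (Y \<union> A)))"
        using IH(2)[of "{x}"] insert by simp
      from quotient_homology[OF this IH(1)] show ?thesis by simp
    qed
    moreover have "region_acyclic c (interval (insert x A) (Y \<union> insert x A \<union> A'))"
      if A': "A' \<subseteq> P" "A' \<noteq> {}" "A' \<inter> insert x A = {}" for A'
    proof -
      interpret subregion c "interval A (insert x (Y \<union> A \<union> A'))" "interval A (Y \<union> A \<union> A')"
        "interval (insert x A) (insert x (Y \<union> A \<union> A'))"
        using x insert.hyps A' by (intro interval_subregion) auto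
      have "region_acyclic c (interval A (insert x (Y \<union> A \<union> A')))"
        using IH(2)[of "insert x A'"] insert A' by simp
      from quotient_acyclic[OF this IH(2)[of A']] A' show ?thesis by auto
    qed
    ultimately show ?case using insert.hyps by simp
  qed
qed

lemma exists_basis_element:
  assumes "Y \<inter> P = {}" "\<not> (\<exists>e\<in>E. e \<subseteq> Y)" "\<And>x. x \<in> P \<Longrightarrow> \<exists>e\<in>E. e \<subseteq> insert x Y" "A \<subseteq> P"
  shows "\<exists>b\<in>B (card A). A \<subseteq> D (card A) b \<and> D (card A) b \<subseteq> Y \<union> A"
proof (rule ccontr)
  assume "\<not> ?thesis"
  then have "interval A (Y \<union> A) (card A) = {}" by (auto simp: interval_def)
  moreover obtain u where "region_cycle c (interval A (Y \<union> A)) (card A) u"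
    "u \<notin> region_map c (interval A (Y \<union> A)) (card A) ` free_mod (interval A (Y \<union> A) (Suc (card A)))"
    using interval_induct[OF assms] by (auto simp: region_homology_def)
  ultimately show False
    by (auto simp: region_cycle_def free_mod_def region_map_def fun_eq_iff image_iff)
qed

end

section \<open>Existence of a squarefree resolution\<close>

text \<open>\<open>T\<close> represents a basis of the span of \<open>Z\<close> modulo that of
  \<open>N\<close>: a maximal independent subset \<open>Q\<close> of \<open>N\<close> is extended
  within \<open>Z\<close> to \<open>R\<close>, and \<open>T\<close> is \<open>R - Q\<close>.\<close>

lemma complement_basis:
  fixes N Z :: "(nat \<Rightarrow> 'k::field) set"
  assumes A: "finite A" and Z: "Z \<subseteq> free_mod A" and N: "N \<subseteq> Z"
  shows "\<exists>T. finite T \<and> T \<subseteq> Z \<and> Z \<subseteq> fun_space.span (N \<union> T) \<and>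
    (\<forall>a. (\<Sum>v\<in>T. (\<lambda>p. a v * v p)) \<in> fun_space.span N \<longrightarrow> (\<forall>v\<in>T. a v = 0))"
proof -
  obtain Q where Q: "Q \<subseteq> N" "fun_space.independent Q" "N \<subseteq> fun_space.span Q"
    using fun_space.maximal_independent_subset[of N] by blast
  obtain R where R: "Q \<subseteq> R" "R \<subseteq> Z" "fun_space.independent R" "Z \<subseteq> fun_space.span R"
    using fun_space.maximal_independent_subset_extend[of Q Z] Q N by blast
  have "R \<subseteq> fun_space.span (unit_vec ` A)"
    using R(2) Z free_mod_subset_span[OF A] by blast
  then have finR: "finite R"
    using fun_space.independent_span_bound[OF _ R(3)] A by blast
  then have finQ: "finite Q" using R(1) finite_subset by blast
  have "Z \<subseteq> fun_space.span (N \<union> (R - Q))"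
    using R(4) Q(1) fun_space.span_mono[of R "N \<union> (R - Q)"] by blast
  moreover have "\<forall>v\<in>R - Q. a v = 0"
    if "(\<Sum>v\<in>R - Q. (\<lambda>p. a v * v p)) \<in> fun_space.span N" for a
  proof -
    have "fun_space.span N \<subseteq> fun_space.span Q"
      using Q(3) by (simp add: fun_space.span_minimal)
    with that obtain b where b: "(\<Sum>v\<in>R - Q. (\<lambda>p. a v * v p)) = (\<Sum>v\<in>Q. (\<lambda>p. b v * v p))"
      using fun_space.span_finite[OF finQ] by auto
    \<comment> \<open>The coefficients of the resulting relation between the elements of
      \<open>R\<close>.\<close>
    define g where "g = (\<lambda>v. if v \<in> Q then - b v else a v)"
    have "(\<Sum>v\<in>R. (\<lambda>p. g v * v p)) = (\<Sum>v\<in>R - Q. (\<lambda>p. g v * v p)) + (\<Sum>v\<in>Q. (\<lambda>p. g v * v p))"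
      using finR R(1) by (rule sum.subset_diff[rotated])
    also have "(\<Sum>v\<in>R - Q. (\<lambda>p. g v * v p)) = (\<Sum>v\<in>R - Q. (\<lambda>p. a v * v p))"
      by (intro sum.cong) (auto simp: g_def)
    also have "(\<Sum>v\<in>Q. (\<lambda>p. g v * v p)) = - (\<Sum>v\<in>Q. (\<lambda>p. b v * v p))"
      by (auto simp: g_def fun_eq_iff sum_fun_apply sum_negf)
    finally have "(\<Sum>v\<in>R. (\<lambda>p. g v * v p)) = 0" by (simp only: b add.right_inverse)
    then have "g v = 0" if "v \<in> R" for v
      using fun_space.independentD[OF R(3) finR] that by blast
    then show ?thesis by (metis DiffD1 DiffD2 g_def)
  qed
  ultimately show ?thesis
    using finR R(2) by (intro exI[of _ "R - Q"]) auto
qed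

lemma subspace_mat_vec_image:
  fixes t :: "nat \<Rightarrow> nat \<Rightarrow> 'k::field"
  shows "fun_space.subspace (mat_vec B t ` free_mod C)"
proof (rule fun_space.subspaceI)
  show "0 \<in> mat_vec B t ` free_mod C"
    by (intro image_eqI[of _ _ 0]) auto
  show "x + y \<in> mat_vec B t ` free_mod C"
    if "x \<in> mat_vec B t ` free_mod C" "y \<in> mat_vec B t ` free_mod C" for x y
    using that free_mod_add by (fastforce simp: mat_vec_add[symmetric])
  show "(\<lambda>p. k * x p) \<in> mat_vec B t ` free_mod C" if x: "x \<in> mat_vec B t ` free_mod C" for k x
  proof -
    obtain u where "u \<in> free_mod C" "x = mat_vec B t u" using x by blast
    then show ?thesis
      by (intro image_eqI[of _ _ "\<lambda>p. k * u p"])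
        (auto simp: mat_vec_def free_mod_def sum_distrib_left algebra_simps)
  qed
qed

text \<open>Graded Nakayama: in degree \<open>W\<close> one takes a basis of \<open>Z W\<close>
  modulo what comes from smaller degrees. The last clause is minimality: no generator of degree
  \<open>W\<close> has a nonzero coefficient in a relation of degree \<open>W\<close>.\<close>

lemma minimal_generators:
  fixes Z :: "'v::finite set \<Rightarrow> (nat \<Rightarrow> 'k::field) set"
  assumes A: "finite A" and sub: "\<And>W. fun_space.subspace (Z W)"
    and ZA: "\<And>W. Z W \<subseteq> free_mod A" and mono: "\<And>W W'. W \<subseteq> W' \<Longrightarrow> Z W \<subseteq> Z W'"
  shows "\<exists>B D t. finite B \<and> t \<in> matrices A B \<and> (\<forall>q\<in>B. (\<lambda>p. t p q) \<in> Z (D q)) \<and>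
    (\<forall>W. Z W \<subseteq> mat_vec B t ` free_mod {q \<in> B. D q \<subseteq> W}) \<and>
    (\<forall>W a q. a \<in> free_mod {q \<in> B. D q \<subseteq> W} \<longrightarrow> mat_vec B t a = 0 \<longrightarrow> q \<in> B \<longrightarrow> D q = W \<longrightarrow> a q = 0)"
proof -
  \<comment> \<open>A union of subspaces and in general not a subspace, so its span appears
    below.\<close>
  define N where "N = (\<lambda>W. \<Union>W'\<in>{W'. W' \<subset> W}. Z W')"
  have NZ: "N W \<subseteq> Z W" for W
    unfolding N_def by (intro UN_least mono) blast
  have "\<forall>W. \<exists>T. finite (T) \<and> T \<subseteq> Z W \<and> Z W \<subseteq> fun_space.span (N W \<union> T) \<and>
    (\<forall>a. (\<Sum>v\<in>T. (\<lambda>p. a v * v p)) \<in> fun_space.span (N W) \<longrightarrow> (\<forall>v\<in>T. a v = 0))"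
    by (intro allI complement_basis[OF A ZA NZ])
  then have "\<exists>T. \<forall>W. finite (T W) \<and> T W \<subseteq> Z W \<and> Z W \<subseteq> fun_space.span (N W \<union> T W) \<and>
    (\<forall>a. (\<Sum>v\<in>T W. (\<lambda>p. a v * v p)) \<in> fun_space.span (N W) \<longrightarrow> (\<forall>v\<in>T W. a v = 0))"
    by (rule choice)
  then obtain T where "\<forall>W. finite (T W) \<and> T W \<subseteq> Z W \<and> Z W \<subseteq> fun_space.span (N W \<union> T W) \<and>
    (\<forall>a. (\<Sum>v\<in>T W. (\<lambda>p. a v * v p)) \<in> fun_space.span (N W) \<longrightarrow> (\<forall>v\<in>T W. a v = 0))"
    by (elim exE)
  then have T: "\<And>W. finite (T W)" "\<And>W. T W \<subseteq> Z W"
    "\<And>W. Z W \<subseteq> fun_space.span (N W \<union> T W)"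
    "\<And>W a v. (\<Sum>v\<in>T W. (\<lambda>p. a v * v p)) \<in> fun_space.span (N W) \<Longrightarrow> v \<in> T W \<Longrightarrow> a v = 0"
    by simp_all
  \<comment> \<open>Basis elements have to be natural numbers, so the pairs of a degree and a
    generator are numbered.\<close>
  have "finite (Sigma UNIV T)" using T(1) by auto
  then obtain f n where f: "Sigma UNIV T = f ` {i::nat. i < n}" "inj_on f {i. i < n}"
    using finite_imp_nat_seg_image_inj_on by metis
  define B where "B = {i. i < n}"
  define D where "D = (\<lambda>i. fst (f i))"
  define t where "t = (\<lambda>p i. if i \<in> B then snd (f i) p else 0)"
  have finB: "finite B" by (simp add: B_def)
  have fB: "f i \<in> Sigma UNIV T" if "i \<in> B" for i using that f by (auto simp: B_def)
  have col: "(\<lambda>p. t p q) \<in> T (D q)" if "q \<in> B" for q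
    using fB[OF that] that by (auto simp: t_def D_def mem_Sigma_iff split_beta)
  have colZ: "(\<lambda>p. t p q) \<in> Z (D q)" if "q \<in> B" for q
    using col[OF that] T(2) by blast
  have "t \<in> matrices A B"
    unfolding matrices_def
  proof safe
    fix p q assume "p \<notin> A"
    show "t p q = 0"
      using colZ[of q] ZA[of "D q"] \<open>p \<notin> A\<close> by (cases "q \<in> B") (auto simp: free_mod_def t_def)
  qed (simp add: t_def)
  moreover have gen: "Z W \<subseteq> mat_vec B t ` free_mod {q \<in> B. D q \<subseteq> W}" for W
  proof -
    have "finite W" by simp
    then show ?thesis
    proof (induction W rule: finite_psubset_induct)
      case (psubset W)
      have "N W \<subseteq> mat_vec B t ` free_mod {q \<in> B. D q \<subseteq> W}"
      proof
        fix u assume "u \<in> N W"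
        then obtain W' where "W' \<subset> W" "u \<in> Z W'" by (auto simp: N_def)
        then have "u \<in> mat_vec B t ` free_mod {q \<in> B. D q \<subseteq> W'}" using psubset by blast
        then show "u \<in> mat_vec B t ` free_mod {q \<in> B. D q \<subseteq> W}"
          using \<open>W' \<subset> W\<close> free_mod_mono[of _ "{q \<in> B. D q \<subseteq> W'}" "{q \<in> B. D q \<subseteq> W}"] by blast
      qed
      moreover have "T W \<subseteq> mat_vec B t ` free_mod {q \<in> B. D q \<subseteq> W}"
      proof
        fix v assume "v \<in> T W"
        then have "(W, v) \<in> f ` {i. i < n}" using f(1) by auto
        then obtain q where q: "q \<in> B" "f q = (W, v)" by (auto simp: B_def)
        then have "v = mat_vec B t (unit_vec q)"
          using mat_vec_unit_vec[OF finB, of q t] by (simp add: t_def)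
        moreover have "unit_vec q \<in> free_mod {q \<in> B. D q \<subseteq> W}"
          using q by (auto simp: free_mod_def unit_vec_def D_def)
        ultimately show "v \<in> mat_vec B t ` free_mod {q \<in> B. D q \<subseteq> W}" by blast
      qed
      ultimately have "fun_space.span (N W \<union> T W) \<subseteq> mat_vec B t ` free_mod {q \<in> B. D q \<subseteq> W}"
        by (intro fun_space.span_minimal subspace_mat_vec_image) auto
      with T(3) show ?case by blast
    qed
  qed
  moreover have "a q = 0" if a: "a \<in> free_mod {q \<in> B. D q \<subseteq> W}" and 0: "mat_vec B t a = 0"
    and q: "q \<in> B" and W: "D q = W" for W a q
  proof -
    \<comment> \<open>The terms of degree properly below \<open>W\<close> lie in the span of
      \<open>N W\<close>; so does, therefore, the sum of those of degree exactly
      \<open>W\<close>.\<close>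
    let ?S = "{q \<in> B. D q = W}" and ?S' = "{q \<in> B. D q \<subset> W}"
    have vec: "mat_vec B t a = (\<Sum>q\<in>B. (\<lambda>p. a q * t p q))"
      by (simp add: mat_vec_def fun_eq_iff sum_fun_apply mult.commute)
    also have "\<dots> = (\<Sum>q\<in>?S \<union> ?S'. (\<lambda>p. a q * t p q))"
      using finB a by (intro sum.mono_neutral_right) (auto simp: free_mod_def fun_eq_iff)
    also have "\<dots> = (\<Sum>q\<in>?S. (\<lambda>p. a q * t p q)) + (\<Sum>q\<in>?S'. (\<lambda>p. a q * t p q))"
      using finB by (intro sum.union_disjoint) auto
    finally have "(\<Sum>q\<in>?S. (\<lambda>p. a q * t p q)) = - (\<Sum>q\<in>?S'. (\<lambda>p. a q * t p q))"
      using 0 by (simp add: eq_neg_iff_add_eq_0)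
    also have "\<dots> \<in> fun_space.span (N W)"
    proof (intro fun_space.span_neg fun_space.span_sum fun_space.span_scale fun_space.span_base)
      fix q assume "q \<in> ?S'"
      then show "(\<lambda>p. t p q) \<in> N W" using colZ by (auto simp: N_def)
    qed
    finally have span: "(\<Sum>q\<in>?S. (\<lambda>p. a q * t p q)) \<in> fun_space.span (N W)" .
    \<comment> \<open>Independence of \<open>T W\<close> is stated for coefficients attached to
      vectors, while \<open>a\<close> is indexed by basis elements; \<open>bij\<close> and its
      inverse \<open>g\<close> translate.\<close>
    have bij: "bij_betw (\<lambda>q. (\<lambda>p. t p q)) ?S (T W)"
    proof (rule bij_betw_imageI)
      show "inj_on (\<lambda>q. (\<lambda>p. t p q)) ?S"
      proof
        fix x y assume xy: "x \<in> ?S" "y \<in> ?S" and eq: "(\<lambda>p. t p x) = (\<lambda>p. t p y)"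
        have "f x = f y" using xy eq by (auto simp: D_def t_def prod_eq_iff)
        then show "x = y" using xy f(2) by (auto simp: B_def inj_on_def)
      qed
      show "(\<lambda>q. (\<lambda>p. t p q)) ` ?S = T W"
      proof
        show "(\<lambda>q. (\<lambda>p. t p q)) ` ?S \<subseteq> T W" using col by auto
        show "T W \<subseteq> (\<lambda>q. (\<lambda>p. t p q)) ` ?S"
        proof
          fix v assume "v \<in> T W"
          then have "(W, v) \<in> f ` {i. i < n}" using f(1) by auto
          then obtain q where "q \<in> B" "f q = (W, v)" by (auto simp: B_def)
          then show "v \<in> (\<lambda>q. (\<lambda>p. t p q)) ` ?S"
            by (intro image_eqI[of _ _ q]) (auto simp: t_def D_def)
        qed
      qed
    qed
    define g where "g = the_inv_into ?S (\<lambda>q. (\<lambda>p. t p q))"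
    have g: "g (\<lambda>p. t p q) = q" if "q \<in> ?S" for q
      unfolding g_def using bij that by (intro the_inv_into_f_f) (auto simp: bij_betw_def)
    have "(\<Sum>v\<in>T W. (\<lambda>p. a (g v) * v p)) = (\<Sum>q\<in>?S. (\<lambda>p. a (g (\<lambda>p. t p q)) * t p q))"
      by (rule sum.reindex_bij_betw[OF bij, symmetric])
    also have "\<dots> = (\<Sum>q\<in>?S. (\<lambda>p. a q * t p q))"
      using g by (intro sum.cong) auto
    finally have "(\<Sum>v\<in>T W. (\<lambda>p. a (g v) * v p)) \<in> fun_space.span (N W)"
      using span by simp
    from T(4)[OF this, of "\<lambda>p. t p q"] show "a q = 0"
      using g[of q] col[OF q] q W by auto
  qed
  ultimately show ?thesis
    using finB colZ by (intro exI[of _ B] exI[of _ D] exI[of _ t]) blast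
qed

text \<open>\<open>Z W\<close> is the degree \<open>W\<close> strand of a syzygy module inside the
  free module on \<open>B\<close>. The last clause is minimality, and the lower bound on the degrees
  makes the construction stop.\<close>

definition syzygy_stage :: "nat \<Rightarrow> nat set \<Rightarrow> (nat \<Rightarrow> 'v::finite set) \<Rightarrow> ('v set \<Rightarrow> (nat \<Rightarrow> 'k::field) set) \<Rightarrow> bool" where
  "syzygy_stage n B D Z \<longleftrightarrow> finite B \<and> (\<forall>q\<in>B. n \<le> card (D q)) \<and>
     (\<forall>W. fun_space.subspace (Z W) \<and> Z W \<subseteq> free_mod {q \<in> B. D q \<subseteq> W}) \<and>
     (\<forall>W W'. W \<subseteq> W' \<longrightarrow> Z W \<subseteq> Z W') \<and>
     (\<forall>W u q. u \<in> Z W \<longrightarrow> q \<in> B \<longrightarrow> D q = W \<longrightarrow> u q = 0)"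

definition strand_kernel ::
  "nat set \<Rightarrow> (nat \<Rightarrow> 'v set) \<Rightarrow> (nat \<Rightarrow> nat \<Rightarrow> 'k::field) \<Rightarrow> 'v set \<Rightarrow> (nat \<Rightarrow> 'k) set" where
  "strand_kernel B D t W = {u \<in> free_mod {q \<in> B. D q \<subseteq> W}. mat_vec B t u = 0}"

lemma subspace_strand_kernel: "fun_space.subspace (strand_kernel B D t W)"
proof (rule fun_space.subspaceI)
  show "(\<lambda>p. k * x p) \<in> strand_kernel B D t W" if "x \<in> strand_kernel B D t W" for k x
  proof -
    have "mat_vec B t (\<lambda>p. k * x p) = (\<lambda>p. k * mat_vec B t x p)"
      by (simp add: mat_vec_def sum_distrib_left algebra_simps)
    then show ?thesis using that by (auto simp: strand_kernel_def free_mod_def fun_eq_iff)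
  qed
qed (auto simp: strand_kernel_def mat_vec_add intro: free_mod_add)

text \<open>By minimality the column of a new generator \<open>q\<close> is nonzero, and it only
  involves old generators of degree properly below \<open>D' q\<close>. So the least possible size
  of a degree grows.\<close>

lemma next_syzygy_stage:
  fixes Z :: "'v::finite set \<Rightarrow> (nat \<Rightarrow> 'k::field) set"
  assumes "syzygy_stage n B D Z"
  shows "\<exists>B' D' t. syzygy_stage (Suc n) B' D' (strand_kernel B' D' t) \<and> t \<in> matrices B B' \<and>
    (\<forall>q\<in>B'. (\<lambda>p. t p q) \<in> Z (D' q)) \<and>
    (\<forall>W. Z W \<subseteq> mat_vec B' t ` free_mod {q \<in> B'. D' q \<subseteq> W})"
proof -
  have Z: "finite B" "\<And>q. q \<in> B \<Longrightarrow> n \<le> card (D q)" "\<And>W. fun_space.subspace (Z W)"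
    "\<And>W. Z W \<subseteq> free_mod {q \<in> B. D q \<subseteq> W}" "\<And>W W'. W \<subseteq> W' \<Longrightarrow> Z W \<subseteq> Z W'"
    "\<And>W u q. u \<in> Z W \<Longrightarrow> q \<in> B \<Longrightarrow> D q = W \<Longrightarrow> u q = 0"
    using assms by (auto simp: syzygy_stage_def)
  have "Z W \<subseteq> free_mod B" for W
    using Z(4) free_mod_mono by blast
  then have "\<exists>B' D' t. finite B' \<and> t \<in> matrices B B' \<and> (\<forall>q\<in>B'. (\<lambda>p. t p q) \<in> Z (D' q)) \<and>
    (\<forall>W. Z W \<subseteq> mat_vec B' t ` free_mod {q \<in> B'. D' q \<subseteq> W}) \<and>
    (\<forall>W a q. a \<in> free_mod {q \<in> B'. D' q \<subseteq> W} \<longrightarrow> mat_vec B' t a = 0 \<longrightarrow> q \<in> B' \<longrightarrow> D' q = W \<longrightarrow> a q = 0)"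
    using Z by (intro minimal_generators) assumption+
  then obtain B' D' t where "finite B' \<and> t \<in> matrices B B' \<and> (\<forall>q\<in>B'. (\<lambda>p. t p q) \<in> Z (D' q)) \<and>
    (\<forall>W. Z W \<subseteq> mat_vec B' t ` free_mod {q \<in> B'. D' q \<subseteq> W}) \<and>
    (\<forall>W a q. a \<in> free_mod {q \<in> B'. D' q \<subseteq> W} \<longrightarrow> mat_vec B' t a = 0 \<longrightarrow> q \<in> B' \<longrightarrow> D' q = W \<longrightarrow> a q = 0)"
    by (elim exE)
  then have t: "finite B'" "t \<in> matrices B B'" "\<And>q. q \<in> B' \<Longrightarrow> (\<lambda>p. t p q) \<in> Z (D' q)"
    "\<And>W. Z W \<subseteq> mat_vec B' t ` free_mod {q \<in> B'. D' q \<subseteq> W}"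
    "\<And>W a q. a \<in> free_mod {q \<in> B'. D' q \<subseteq> W} \<Longrightarrow> mat_vec B' t a = 0 \<Longrightarrow> q \<in> B' \<Longrightarrow> D' q = W \<Longrightarrow> a q = 0"
    by simp_all
  have "Suc n \<le> card (D' q)" if q: "q \<in> B'" for q
  proof -
    have "unit_vec q \<in> free_mod {q' \<in> B'. D' q' \<subseteq> D' q}"
      using q by (intro unit_vec_free) simp
    moreover have "unit_vec q q \<noteq> (0::'k)" by (simp add: unit_vec_def)
    ultimately have "mat_vec B' t (unit_vec q) \<noteq> 0"
      using t(5)[of "unit_vec q" "D' q" q] q by blast
    then obtain p where p: "t p q \<noteq> 0"
      using mat_vec_unit_vec[OF t(1) q, of t] by (auto simp: fun_eq_iff)
    then have "p \<in> B" "D p \<subseteq> D' q" using t(3)[OF q] Z(4)[of "D' q"] by (auto simp: free_mod_def)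
    moreover have "D p \<noteq> D' q" using Z(6)[OF t(3)[OF q] \<open>p \<in> B\<close>] p by auto
    ultimately have "D p \<subset> D' q" by blast
    then have "card (D p) < card (D' q)" by (simp add: psubset_card_mono)
    then show ?thesis using Z(2)[OF \<open>p \<in> B\<close>] by simp
  qed
  moreover have "strand_kernel B' D' t W \<subseteq> strand_kernel B' D' t W'" if "W \<subseteq> W'" for W W'
    using that by (auto simp: strand_kernel_def free_mod_def)
  ultimately have "syzygy_stage (Suc n) B' D' (strand_kernel B' D' t)"
    unfolding syzygy_stage_def using t(1,5) subspace_strand_kernel
    by (auto simp: strand_kernel_def)
  with t show ?thesis by blast
qed

text \<open>An empty edge would put the generator of the ring into the ideal in its own degree
  \<open>{}\<close>, against minimality of stage 0.\<close>

lemma squarefree_resolution_exists: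
  fixes E :: "'v::finite set set"
  assumes "{} \<notin> E"
  shows "\<exists>B D (c :: nat \<Rightarrow> nat \<Rightarrow> nat \<Rightarrow> 'k::field). squarefree_resolution E B D c"
proof -
  \<comment> \<open>The ideal, strand by strand: one-dimensional in degree \<open>W\<close> if
    \<open>W\<close> contains an edge, else zero.\<close>
  define Z0 :: "'v set \<Rightarrow> (nat \<Rightarrow> 'k) set" where
    "Z0 = (\<lambda>W. {u \<in> free_mod {0}. (\<exists>e\<in>E. e \<subseteq> W) \<or> u = 0})"
  \<comment> \<open>In a state (\<open>B\<close>, \<open>D\<close>, \<open>t\<close>,
    \<open>Z\<close>) the matrix \<open>t\<close> leads to the previous state. So \<open>c i\<close>
    is stored in state \<open>Suc i\<close>, and the matrix of state 0 is a dummy.\<close>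
  define P :: "nat \<Rightarrow> nat set \<times> (nat \<Rightarrow> 'v set) \<times> (nat \<Rightarrow> nat \<Rightarrow> 'k) \<times> ('v set \<Rightarrow> (nat \<Rightarrow> 'k) set) \<Rightarrow> bool"
    where "P = (\<lambda>n (B, D, t, Z). syzygy_stage n B D Z \<and> (n = 0 \<longrightarrow> B = {0} \<and> D 0 = {} \<and> Z = Z0))"
  define Q :: "nat \<Rightarrow> nat set \<times> (nat \<Rightarrow> 'v set) \<times> (nat \<Rightarrow> nat \<Rightarrow> 'k) \<times> ('v set \<Rightarrow> (nat \<Rightarrow> 'k) set) \<Rightarrow>
    nat set \<times> (nat \<Rightarrow> 'v set) \<times> (nat \<Rightarrow> nat \<Rightarrow> 'k) \<times> ('v set \<Rightarrow> (nat \<Rightarrow> 'k) set) \<Rightarrow> bool"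
    where "Q = (\<lambda>n (B, D, _, Z) (B', D', t, Z'). Z' = strand_kernel B' D' t \<and> t \<in> matrices B B' \<and>
    (\<forall>q\<in>B'. (\<lambda>p. t p q) \<in> Z (D' q)) \<and>
    (\<forall>W. Z W \<subseteq> mat_vec B' t ` free_mod {q \<in> B'. D' q \<subseteq> W}))"
  have "\<exists>s. \<forall>n. P n (s n) \<and> Q n (s n) (s (Suc n))"
  proof (rule dependent_nat_choice)
    have "fun_space.subspace (Z0 W)" for W
      by (rule fun_space.subspaceI) (auto simp: Z0_def free_mod_def fun_eq_iff)
    then have "syzygy_stage 0 {0} (\<lambda>_. {}) Z0"
      unfolding syzygy_stage_def using assms by (auto simp: Z0_def)
    then show "\<exists>s. P 0 s"
      by (intro exI[of _ "({0}, \<lambda>_. {}, 0, Z0)"]) (simp add: P_def)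
  next
    fix s n assume "P n s"
    then obtain B D t Z where s: "s = (B, D, t, Z)" "syzygy_stage n B D Z"
      by (cases s) (auto simp: P_def)
    from next_syzygy_stage[OF s(2)] obtain B' D' t' where
      "syzygy_stage (Suc n) B' D' (strand_kernel B' D' t')" "t' \<in> matrices B B'"
      "\<forall>q\<in>B'. (\<lambda>p. t' p q) \<in> Z (D' q)"
      "\<forall>W. Z W \<subseteq> mat_vec B' t' ` free_mod {q \<in> B'. D' q \<subseteq> W}" by blast
    then show "\<exists>s'. P (Suc n) s' \<and> Q n s s'"
      by (intro exI[of _ "(B', D', t', strand_kernel B' D' t')"]) (simp add: P_def Q_def s)
  qed
  then obtain s where s: "\<And>n. P n (s n)" "\<And>n. Q n (s n) (s (Suc n))" by blast
  define B where "B = (\<lambda>i. fst (s i))"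
  define D where "D = (\<lambda>i. fst (snd (s i)))"
  define c where "c = (\<lambda>i. fst (snd (snd (s (Suc i)))))"
  define Z where "Z = (\<lambda>i. snd (snd (snd (s i))))"
  have stage: "syzygy_stage i (B i) (D i) (Z i)" for i
    using s(1)[of i] by (simp add: P_def B_def D_def Z_def split: prod.splits)
  have zero: "B 0 = {0}" "D 0 0 = {}" "Z 0 = Z0"
    using s(1)[of 0] by (simp_all add: P_def B_def D_def Z_def split: prod.splits)
  have step: "Z (Suc i) = strand_kernel (B (Suc i)) (D (Suc i)) (c i)" "c i \<in> matrices (B i) (B (Suc i))"
    "\<And>q. q \<in> B (Suc i) \<Longrightarrow> (\<lambda>p. c i p q) \<in> Z i (D (Suc i) q)"
    "Z i W \<subseteq> mat_vec (B (Suc i)) (c i) ` free_mod {q \<in> B (Suc i). D (Suc i) q \<subseteq> W}" for i W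
    using s(2)[of i] by (simp_all add: Q_def B_def D_def Z_def c_def split: prod.splits)
  have Z: "finite (B i)" "\<And>q. q \<in> B i \<Longrightarrow> i \<le> card (D i q)"
    "\<And>W. Z i W \<subseteq> free_mod {q \<in> B i. D i q \<subseteq> W}"
    "\<And>W u q. u \<in> Z i W \<Longrightarrow> q \<in> B i \<Longrightarrow> D i q = W \<Longrightarrow> u q = 0" for i
    using stage[of i] by (auto simp: syzygy_stage_def)
  have "squarefree_resolution E B D c"
  proof
    have "mat_mult (B (Suc i)) (c i) (c (Suc i)) = 0" for i
    proof (intro ext)
      fix p r
      show "mat_mult (B (Suc i)) (c i) (c (Suc i)) p r = 0 p r"
      proof (cases "r \<in> B (Suc (Suc i))")
        case True
        then have "mat_vec (B (Suc i)) (c i) (\<lambda>p. c (Suc i) p r) = 0"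
          using step(3)[OF True] step(1)[of i] by (simp add: strand_kernel_def)
        then show ?thesis by (simp add: mat_vec_def mat_mult_def fun_eq_iff)
      next
        case False
        then show ?thesis using step(2)[of "Suc i"] by (simp add: matrices_def mat_mult_def)
      qed
    qed
    then show "complex_on B c" using Z(1) step(2) by (simp add: complex_on_def)
    show "D i p \<subset> D (Suc i) q" if cpq: "c i p q \<noteq> 0" for i p q
    proof -
      have "p \<in> B i" "q \<in> B (Suc i)" using cpq step(2)[of i] by (auto simp: matrices_def)
      then have "D i p \<subseteq> D (Suc i) q" "D i p \<noteq> D (Suc i) q"
        using cpq step(3)[of q i] Z(3)[of i "D (Suc i) q"] Z(4)[of "\<lambda>p. c i p q" i "D (Suc i) q" p]
        by (auto simp: free_mod_def)
      then show ?thesis by blast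
    qed
    show "\<exists>e\<in>E. e \<subseteq> D 1 q" if q: "q \<in> B 1" for q
    proof -
      have "(\<lambda>p. c 0 p q) \<in> Z0 (D 1 q)" using step(3)[of q 0] q zero(3) by simp
      moreover have "(\<lambda>p. c 0 p q) \<noteq> 0"
      proof
        assume "(\<lambda>p. c 0 p q) = 0"
        then have "mat_vec (B 1) (c 0) (unit_vec q) = 0"
          using mat_vec_unit_vec[OF Z(1) q, of "c 0"] by simp
        then have "unit_vec q \<in> Z 1 (D 1 q)"
          using step(1)[of 0] q by (simp add: strand_kernel_def unit_vec_free)
        from Z(4)[OF this q] show False by (simp add: unit_vec_def)
      qed
      ultimately show ?thesis by (simp add: Z0_def)
    qed
    show "unit_vec 0 \<in> mat_vec (B 1) (c 0) ` free_mod {q \<in> B 1. D 1 q \<subseteq> W}"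
      if "e \<in> E" "e \<subseteq> W" for e W
    proof -
      have "unit_vec 0 \<in> Z 0 W"
        using that unfolding zero(3) by (auto simp: Z0_def free_mod_def unit_vec_def)
      then show ?thesis using step(4)[of 0 W] by auto
    qed
    show "u \<in> mat_vec (B (Suc (Suc i))) (c (Suc i)) ` free_mod {q \<in> B (Suc (Suc i)). D (Suc (Suc i)) q \<subseteq> W}"
      if "u \<in> free_mod {q \<in> B (Suc i). D (Suc i) q \<subseteq> W}" "mat_vec (B (Suc i)) (c i) u = 0" for u i W
      using that step(4)[of "Suc i" W] step(1)[of i] by (auto simp: strand_kernel_def)
    show "B i = {}" if "i > card (UNIV :: 'v set)" for i
    proof (rule ccontr)
      assume "B i \<noteq> {}"
      then obtain q where "q \<in> B i" by blast
      from Z(2)[OF this] card_mono[of UNIV "D i q"] that show False by simp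
    qed
  qed (use zero in auto)
  then show ?thesis by blast
qed

section \<open>The resolution over the polynomial ring\<close>

interpretation ring_module: module "(*) :: 'a::comm_ring_1 \<Rightarrow> 'a \<Rightarrow> 'a"
  by unfold_locales (simp_all add: algebra_simps)

section \<open>Squarefree monomials and the edge ideal\<close>

definition vars_exp :: "'v::finite set \<Rightarrow> 'v \<Rightarrow>\<^sub>0 nat" where
  "vars_exp U = (\<Sum>v\<in>U. Poly_Mapping.single v 1)"

lemma lookup_vars_exp: "Poly_Mapping.lookup (vars_exp U) v = (if v \<in> U then 1 else 0)"
proof -
  have "Poly_Mapping.lookup (vars_exp U) v = (\<Sum>w\<in>U. if v = w then 1 else 0)"
    unfolding vars_exp_def lookup_sum by (intro sum.cong) (auto simp: lookup_single when_def)
  then show ?thesis by simp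
qed

lemma vars_exp_empty [simp]: "vars_exp {} = 0"
  by (simp add: vars_exp_def)

lemma vars_exp_add_diff: "U \<subseteq> W \<Longrightarrow> vars_exp U + vars_exp (W - U) = vars_exp W"
  by (rule poly_mapping_eqI) (auto simp: lookup_add lookup_vars_exp)

lemma keys_vars_exp_add: "U \<subseteq> Poly_Mapping.keys (vars_exp U + \<gamma>)"
  by (auto simp: in_keys_iff lookup_add lookup_vars_exp)

text \<open>Subtraction of exponents is truncated; \<open>U\<close> lying in the support makes it
  exact.\<close>

lemma vars_exp_split: "U \<subseteq> Poly_Mapping.keys \<alpha> \<Longrightarrow> \<alpha> = vars_exp U + (\<alpha> - vars_exp U)"
  by (rule poly_mapping_eqI)
    (force simp: lookup_add lookup_minus lookup_vars_exp in_keys_iff)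

lemma prod_var: "(\<Prod>v\<in>U. var v) = (Poly_Mapping.single (vars_exp U) 1 :: ('v::finite, 'k::field) polys)"
proof -
  have "finite U" by simp
  then show ?thesis
    by (induction U rule: finite_induct) (simp_all add: vars_exp_def var_def mult_single)
qed

lemma lookup_single_mult_add:
  fixes f :: "('v, 'k::field) polys"
  shows "Poly_Mapping.lookup (Poly_Mapping.single m a * f) (m + \<gamma>) = a * Poly_Mapping.lookup f \<gamma>"
  by (simp add: lookup_mult lookup_single when_mult)

lemma lookup_single_mult_outside:
  fixes f :: "('v, 'k::field) polys"
  assumes "\<And>\<gamma>. \<beta> \<noteq> m + \<gamma>"
  shows "Poly_Mapping.lookup (Poly_Mapping.single m a * f) \<beta> = 0"
  using assms by (simp add: lookup_mult lookup_single when_mult)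

text \<open>Exponents add up to zero only if both are zero. Hence the constant coefficient is
  multiplicative and can serve as \<open>\<epsilon>\<close>.\<close>

lemma lookup_mult_0:
  fixes f g :: "('v, 'k::field) polys"
  shows "Poly_Mapping.lookup (f * g) 0 = Poly_Mapping.lookup f 0 * Poly_Mapping.lookup g 0"
proof -
  have *: "0 = l + q \<longleftrightarrow> l = 0 \<and> q = 0" for l q :: "'v \<Rightarrow>\<^sub>0 nat"
  proof
    assume "0 = l + q"
    then have "Poly_Mapping.lookup l v + Poly_Mapping.lookup q v = 0" for v
      by (metis lookup_add lookup_zero)
    then show "l = 0 \<and> q = 0" by (auto intro: poly_mapping_eqI)
  qed simp
  have "(\<Sum>q. Poly_Mapping.lookup g q when 0 = l + q) = (Poly_Mapping.lookup g 0 when l = 0)" for l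
    by (cases "l = 0") (simp_all add: *)
  then show ?thesis by (simp add: lookup_mult mult_when)
qed

text \<open>A monomial is divisible by the squarefree monomial of \<open>e\<close> exactly if its
  support contains \<open>e\<close>.\<close>

lemma edge_ideal_eq:
  fixes E :: "'v::finite set set"
  shows "(edge_ideal E :: ('v, 'k::field) polys set) =
    {f. \<forall>m\<in>Poly_Mapping.keys f. \<exists>e\<in>E. e \<subseteq> Poly_Mapping.keys m}"
    (is "_ = ?R")
proof
  have "(\<lambda>e. \<Prod>v\<in>e. var v) ` E \<subseteq> ?R"
  proof safe
    fix e m assume e: "e \<in> E" and "m \<in> Poly_Mapping.keys (\<Prod>v\<in>e. var v :: ('v, 'k) polys)"
    then have "m = vars_exp e" by (simp add: prod_var)
    with e keys_vars_exp_add[of e 0] show "\<exists>e\<in>E. e \<subseteq> Poly_Mapping.keys m" by auto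
  qed
  moreover have "ring_module.subspace ?R"
  proof (rule ring_module.subspaceI)
    show "f + g \<in> ?R" if "f \<in> ?R" "g \<in> ?R" for f g
      using that keys_add[of f g] by blast
    show "h * f \<in> ?R" if f: "f \<in> ?R" for h f
    proof safe
      fix m assume "m \<in> Poly_Mapping.keys (h * f)"
      then obtain a b where b: "b \<in> Poly_Mapping.keys f" "m = a + b"
        using keys_mult[of h f] by blast
      then obtain e where "e \<in> E" "e \<subseteq> Poly_Mapping.keys b" using f by auto
      moreover have "Poly_Mapping.keys b \<subseteq> Poly_Mapping.keys m"
        using b(2) by (auto simp: in_keys_iff lookup_add)
      ultimately show "\<exists>e\<in>E. e \<subseteq> Poly_Mapping.keys m" by auto
    qed
  qed simp
  ultimately show "edge_ideal E \<subseteq> ?R"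
    unfolding edge_ideal_def ideal_gen_def by (rule ring_module.span_minimal)
  show "?R \<subseteq> edge_ideal E"
  proof
    fix f assume f: "f \<in> ?R"
    have "f = (\<Sum>m\<in>Poly_Mapping.keys f. Poly_Mapping.single m (Poly_Mapping.lookup f m))"
    proof (rule poly_mapping_eqI)
      fix k
      have "(\<Sum>m\<in>Poly_Mapping.keys f. Poly_Mapping.lookup (Poly_Mapping.single m (Poly_Mapping.lookup f m)) k)
        = (\<Sum>m\<in>Poly_Mapping.keys f. if k = m then Poly_Mapping.lookup f k else 0)"
        by (intro sum.cong) (auto simp: lookup_single when_def)
      then show "Poly_Mapping.lookup f k =
        Poly_Mapping.lookup (\<Sum>m\<in>Poly_Mapping.keys f. Poly_Mapping.single m (Poly_Mapping.lookup f m)) k"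
        by (simp add: lookup_sum in_keys_iff)
    qed
    also have "\<dots> \<in> edge_ideal E"
      unfolding edge_ideal_def ideal_gen_def
    proof (rule ring_module.span_sum)
      fix m assume "m \<in> Poly_Mapping.keys f"
      then obtain e where e: "e \<in> E" "e \<subseteq> Poly_Mapping.keys m" using f by blast
      have "Poly_Mapping.single m (Poly_Mapping.lookup f m) =
        Poly_Mapping.single (m - vars_exp e) (Poly_Mapping.lookup f m) * (\<Prod>v\<in>e. var v)"
        using vars_exp_split[OF e(2)] by (simp add: prod_var mult_single add.commute)
      also have "\<dots> \<in> ring_module.span ((\<lambda>e. \<Prod>v\<in>e. var v) ` E)"
        using e(1) by (intro ring_module.span_scale ring_module.span_base) auto
      finally show "Poly_Mapping.single m (Poly_Mapping.lookup f m) \<in>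
        ring_module.span ((\<lambda>e. \<Prod>v\<in>e. var v) ` E)" .
    qed
    finally show "f \<in> edge_ideal E" .
  qed
qed

lemma irrelevant_ideal_lookup_0:
  "f \<in> (irrelevant_ideal :: ('v, 'k::field) polys set) \<Longrightarrow> Poly_Mapping.lookup f 0 = 0"
proof -
  have "range var \<subseteq> {f :: ('v, 'k) polys. Poly_Mapping.lookup f 0 = 0}"
  proof safe
    fix v :: 'v
    have "Poly_Mapping.single v (1::nat) \<noteq> 0"
      by (metis lookup_single_eq lookup_zero zero_neq_one)
    then show "Poly_Mapping.lookup (var v :: ('v, 'k) polys) 0 = 0"
      by (simp add: var_def lookup_single when_def)
  qed
  moreover have "ring_module.subspace {f :: ('v, 'k) polys. Poly_Mapping.lookup f 0 = 0}"
    by (rule ring_module.subspaceI) (auto simp: lookup_add lookup_mult_0)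
  ultimately have "irrelevant_ideal \<subseteq> {f :: ('v, 'k) polys. Poly_Mapping.lookup f 0 = 0}"
    unfolding irrelevant_ideal_def ideal_gen_def by (rule ring_module.span_minimal)
  then show "f \<in> (irrelevant_ideal :: ('v, 'k) polys set) \<Longrightarrow> Poly_Mapping.lookup f 0 = 0" by blast
qed

lemma single_in_irrelevant_ideal:
  assumes "U \<noteq> {}"
  shows "Poly_Mapping.single (vars_exp U) a \<in> (irrelevant_ideal :: ('v::finite, 'k::field) polys set)"
proof -
  obtain v where v: "v \<in> U" using assms by blast
  have "vars_exp {v} + vars_exp (U - {v}) = vars_exp U"
    using v by (intro vars_exp_add_diff) auto
  then have "Poly_Mapping.single (vars_exp U) a =
    Poly_Mapping.single (vars_exp (U - {v})) a * (var v :: ('v, 'k) polys)"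
    by (simp add: var_def mult_single vars_exp_def add.commute)
  also have "\<dots> \<in> irrelevant_ideal"
    unfolding irrelevant_ideal_def ideal_gen_def
    by (intro ring_module.span_scale ring_module.span_base) auto
  finally show ?thesis .
qed

section \<open>Homogenising the scalar complex\<close>

context squarefree_resolution
begin

definition lift_mat :: "nat \<Rightarrow> nat \<Rightarrow> nat \<Rightarrow> ('v, 'k) polys" where
  "lift_mat i p q = Poly_Mapping.single (vars_exp (D (Suc i) q - D i p)) (c i p q)"

text \<open>The component of multidegree \<open>\<alpha>\<close> of a vector whose basis element
  \<open>p\<close> has degree \<open>D i p\<close>. The guard keeps the truncated subtraction
  exact.\<close>

definition strand :: "nat \<Rightarrow> ('v \<Rightarrow>\<^sub>0 nat) \<Rightarrow> (nat \<Rightarrow> ('v, 'k) polys) \<Rightarrow> nat \<Rightarrow> 'k" where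
  "strand i \<alpha> u p = (if D i p \<subseteq> Poly_Mapping.keys \<alpha>
     then Poly_Mapping.lookup (u p) (\<alpha> - vars_exp (D i p)) else 0)"

lemma strand_add: "strand i (vars_exp (D i p) + \<beta>) u p = Poly_Mapping.lookup (u p) \<beta>"
  using keys_vars_exp_add[of "D i p" \<beta>] by (simp add: strand_def)

lemma strand_eqI: "(\<And>\<alpha>. strand i \<alpha> u = strand i \<alpha> v) \<Longrightarrow> u = v"
  by (intro ext poly_mapping_eqI) (metis strand_add)

lemma strand_zero [simp]: "strand i \<alpha> 0 = 0"
  by (simp add: strand_def fun_eq_iff)

lemma strand_free: "u \<in> free_mod (B i) \<Longrightarrow>
    strand i \<alpha> u \<in> free_mod {q \<in> B i. D i q \<subseteq> Poly_Mapping.keys \<alpha>}"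
  by (auto simp: strand_def free_mod_def)

text \<open>In a fixed multidegree the monomials cancel and only the scalars \<open>c\<close>
  remain. If \<open>D (Suc i) q\<close> is not in the support of \<open>\<alpha>\<close>, the entry
  at \<open>q\<close> contributes nothing to this multidegree.\<close>

lemma strand_lift_mat:
  "strand i \<alpha> (mat_vec (B (Suc i)) (lift_mat i) w) = mat_vec (B (Suc i)) (c i) (strand (Suc i) \<alpha> w)"
proof
  fix p
  show "strand i \<alpha> (mat_vec (B (Suc i)) (lift_mat i) w) p =
    mat_vec (B (Suc i)) (c i) (strand (Suc i) \<alpha> w) p"
  proof (cases "D i p \<subseteq> Poly_Mapping.keys \<alpha>")
    case True
    define \<beta> where "\<beta> = \<alpha> - vars_exp (D i p)"
    have \<alpha>: "\<alpha> = vars_exp (D i p) + \<beta>" using vars_exp_split[OF True] by (simp add: \<beta>_def)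
    have "Poly_Mapping.lookup (lift_mat i p q * w q) \<beta> = c i p q * strand (Suc i) \<alpha> w q" for q
    proof (cases "c i p q = 0")
      case True
      then show ?thesis by (simp add: lift_mat_def)
    next
      case False
      then have "D i p \<subseteq> D (Suc i) q" using c_degree by blast
      then have eq: "vars_exp (D i p) + vars_exp (D (Suc i) q - D i p) = vars_exp (D (Suc i) q)"
        by (rule vars_exp_add_diff)
      show ?thesis
      proof (cases "D (Suc i) q \<subseteq> Poly_Mapping.keys \<alpha>")
        case True
        define \<gamma> where "\<gamma> = \<alpha> - vars_exp (D (Suc i) q)"
        have "vars_exp (D i p) + \<beta> = vars_exp (D i p) + (vars_exp (D (Suc i) q - D i p) + \<gamma>)"
          using vars_exp_split[OF True] \<alpha> eq by (simp add: \<gamma>_def add.assoc[symmetric])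
        then have "\<beta> = vars_exp (D (Suc i) q - D i p) + \<gamma>" by simp
        then show ?thesis
          using True by (simp add: lift_mat_def lookup_single_mult_add strand_def \<gamma>_def)
      next
        case False
        have "\<beta> \<noteq> vars_exp (D (Suc i) q - D i p) + \<gamma>" for \<gamma>
        proof
          assume "\<beta> = vars_exp (D (Suc i) q - D i p) + \<gamma>"
          then have "\<alpha> = vars_exp (D (Suc i) q) + \<gamma>" using \<alpha> eq by (simp add: add.assoc[symmetric])
          with False keys_vars_exp_add show False by blast
        qed
        with False show ?thesis by (simp add: lift_mat_def lookup_single_mult_outside strand_def)
      qed
    qed
    with True show ?thesis by (simp add: strand_def[of i] mat_vec_def lookup_sum \<beta>_def[symmetric])
  next
    case False
    have "mat_vec (B (Suc i)) (c i) (strand (Suc i) \<alpha> w) p = 0"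
      unfolding mat_vec_def using False c_degree[of i p]
      by (intro sum.neutral) (fastforce simp: strand_def)
    with False show ?thesis by (simp add: strand_def[of i])
  qed
qed

text \<open>Preimages are chosen strand by strand and glued. As only finitely many strands of
  \<open>u\<close> are nonzero, taking 0 over the zero strands makes the glued coefficients
  polynomials.\<close>

lemma lift_mat_image:
  assumes strands: "\<And>\<alpha>. strand i \<alpha> u \<in>
    mat_vec (B (Suc i)) (c i) ` free_mod {q \<in> B (Suc i). D (Suc i) q \<subseteq> Poly_Mapping.keys \<alpha>}"
    and u: "u \<in> free_mod (B i)"
  shows "u \<in> mat_vec (B (Suc i)) (lift_mat i) ` free_mod (B (Suc i))"
proof -
  let ?F = "\<lambda>\<alpha>. free_mod {q \<in> B (Suc i). D (Suc i) q \<subseteq> Poly_Mapping.keys \<alpha>} :: (nat \<Rightarrow> 'k) set"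
  have "\<exists>w. w \<in> ?F \<alpha> \<and> mat_vec (B (Suc i)) (c i) w = strand i \<alpha> u \<and> (strand i \<alpha> u = 0 \<longrightarrow> w = 0)" for \<alpha>
  proof (cases "strand i \<alpha> u = 0")
    case True
    then show ?thesis by (rule_tac exI[of _ 0]) simp
  next
    case False
    then show ?thesis using strands[of \<alpha>] by auto
  qed
  then have "\<exists>W. \<forall>\<alpha>. W \<alpha> \<in> ?F \<alpha> \<and> mat_vec (B (Suc i)) (c i) (W \<alpha>) = strand i \<alpha> u \<and>
    (strand i \<alpha> u = 0 \<longrightarrow> W \<alpha> = 0)"
    by (intro choice allI)
  then obtain W where "\<forall>\<alpha>. W \<alpha> \<in> ?F \<alpha> \<and> mat_vec (B (Suc i)) (c i) (W \<alpha>) = strand i \<alpha> u \<and>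
    (strand i \<alpha> u = 0 \<longrightarrow> W \<alpha> = 0)" by (elim exE)
  then have W: "\<And>\<alpha>. W \<alpha> \<in> ?F \<alpha>" "\<And>\<alpha>. mat_vec (B (Suc i)) (c i) (W \<alpha>) = strand i \<alpha> u"
    "\<And>\<alpha>. strand i \<alpha> u = 0 \<Longrightarrow> W \<alpha> = 0" by blast+
  have "{\<alpha>. strand i \<alpha> u \<noteq> 0} \<subseteq>
    (\<Union>p\<in>B i. (\<lambda>\<gamma>. vars_exp (D i p) + \<gamma>) ` Poly_Mapping.keys (u p))"
  proof safe
    fix \<alpha> assume "strand i \<alpha> u \<noteq> 0"
    then obtain p where p: "strand i \<alpha> u p \<noteq> 0" by (auto simp: fun_eq_iff)
    then have "p \<in> B i" "D i p \<subseteq> Poly_Mapping.keys \<alpha>"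
      "\<alpha> - vars_exp (D i p) \<in> Poly_Mapping.keys (u p)"
      using u by (auto simp: strand_def free_mod_def in_keys_iff split: if_splits)
    with vars_exp_split
    show "\<alpha> \<in> (\<Union>p\<in>B i. (\<lambda>\<gamma>. vars_exp (D i p) + \<gamma>) ` Poly_Mapping.keys (u p))"
      by blast
  qed
  then have fin: "finite {\<alpha>. strand i \<alpha> u \<noteq> 0}"
    by (rule finite_subset) (simp add: finite_B)
  have "finite {\<beta>. W (vars_exp (D (Suc i) q) + \<beta>) q \<noteq> 0}" for q
  proof (rule finite_subset)
    show "{\<beta>. W (vars_exp (D (Suc i) q) + \<beta>) q \<noteq> 0} \<subseteq>
      (\<lambda>\<beta>. vars_exp (D (Suc i) q) + \<beta>) -` {\<alpha>. strand i \<alpha> u \<noteq> 0}"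
      using W(3) by force
    show "finite ((\<lambda>\<beta>. vars_exp (D (Suc i) q) + \<beta>) -` {\<alpha>. strand i \<alpha> u \<noteq> 0})"
      using fin by (rule finite_vimageI) (simp add: inj_on_def)
  qed
  note fin' = this
  \<comment> \<open>The coefficient of \<open>w q\<close> at \<open>\<beta>\<close> has multidegree
    \<open>vars_exp (D (Suc i) q) + \<beta>\<close>.\<close>
  define w where "w = (\<lambda>q. Abs_poly_mapping (\<lambda>\<beta>. W (vars_exp (D (Suc i) q) + \<beta>) q))"
  have lookup_w: "Poly_Mapping.lookup (w q) \<beta> = W (vars_exp (D (Suc i) q) + \<beta>) q" for q \<beta>
    using fin'[of q] by (simp add: w_def)
  have "strand (Suc i) \<alpha> w = W \<alpha>" for \<alpha>
  proof
    fix q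
    show "strand (Suc i) \<alpha> w q = W \<alpha> q"
    proof (cases "D (Suc i) q \<subseteq> Poly_Mapping.keys \<alpha>")
      case True
      then show ?thesis
        using vars_exp_split[OF True] by (simp add: strand_def lookup_w)
    next
      case False
      then show ?thesis using W(1)[of \<alpha>] by (simp add: strand_def free_mod_def)
    qed
  qed
  then have "mat_vec (B (Suc i)) (lift_mat i) w = u"
    by (intro strand_eqI[of i]) (simp add: strand_lift_mat W(2))
  moreover have "w \<in> free_mod (B (Suc i))"
    unfolding free_mod_def
  proof safe
    fix q assume "q \<notin> B (Suc i)"
    then show "w q = 0"
      using W(1) by (intro poly_mapping_eqI) (simp add: lookup_w free_mod_def)
  qed
  ultimately show ?thesis by blast
qed

lemma lift_mat_matrices: "lift_mat i \<in> matrices (B i) (B (Suc i))"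
  by (auto simp: matrices_def lift_mat_def c_outside)

lemma lift_mat_exact: "exact_on B lift_mat"
  unfolding exact_on_def complex_on_def
proof (intro conjI allI ballI impI)
  fix i
  show "finite (B i)" by (rule finite_B)
  show "lift_mat i \<in> matrices (B i) (B (Suc i))" by (rule lift_mat_matrices)
  show "mat_mult (B (Suc i)) (lift_mat i) (lift_mat (Suc i)) = 0"
  proof (rule mat_mult_zeroI[OF finite_B lift_mat_matrices], rule strand_eqI[of i])
    fix w \<alpha>
    show "strand i \<alpha> (mat_vec (B (Suc i)) (lift_mat i) (mat_vec (B (Suc (Suc i))) (lift_mat (Suc i)) w))
      = strand i \<alpha> 0"
      unfolding strand_lift_mat unfolding mat_vec_mat_vec c_square by simp
  qed
  fix u assume u: "u \<in> free_mod (B (Suc i))" "mat_vec (B (Suc i)) (lift_mat i) u = 0"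
  show "u \<in> mat_vec (B (Suc (Suc i))) (lift_mat (Suc i)) ` free_mod (B (Suc (Suc i)))"
  proof (rule lift_mat_image[OF _ u(1)], rule exact_Suc[OF strand_free[OF u(1)]])
    fix \<alpha>
    show "mat_vec (B (Suc i)) (c i) (strand (Suc i) \<alpha> u) = 0"
      using strand_lift_mat[of i \<alpha> u] u(2) by simp
  qed
qed

text \<open>Membership in the ideal is decided in each multidegree by whether its support contains
  an edge: \<open>D_1\<close> gives one inclusion, \<open>exact_0\<close> the other.\<close>

lemma lift_mat_0_image:
  "mat_vec (B 1) (lift_mat 0) ` free_mod (B 1) = {u \<in> free_mod {0}. u 0 \<in> edge_ideal E}"
proof
  show "mat_vec (B 1) (lift_mat 0) ` free_mod (B 1) \<subseteq> {u \<in> free_mod {0}. u 0 \<in> edge_ideal E}"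
  proof
    fix u assume "u \<in> mat_vec (B 1) (lift_mat 0) ` free_mod (B 1)"
    then obtain w where w: "w \<in> free_mod (B 1)" "u = mat_vec (B 1) (lift_mat 0) w" by blast
    have "u \<in> free_mod {0}"
      using w(2) lift_mat_matrices[of 0] B_0 by (simp add: free_mod_def mat_vec_def matrices_def)
    moreover have "\<exists>e\<in>E. e \<subseteq> Poly_Mapping.keys m" if m: "m \<in> Poly_Mapping.keys (u 0)" for m
    proof -
      have "Poly_Mapping.lookup (u 0) m = strand 0 m u 0"
        by (simp add: strand_def D_0)
      also have "\<dots> = mat_vec (B 1) (c 0) (strand 1 m w) 0"
        using strand_lift_mat[of 0 m w] w(2) by simp
      finally have "(\<Sum>q\<in>B 1. c 0 0 q * strand 1 m w q) \<noteq> 0"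
        using m by (simp add: in_keys_iff mat_vec_def)
      then obtain q where q: "q \<in> B 1" "strand 1 m w q \<noteq> 0"
        by (metis (no_types, lifting) mult_zero_right sum.neutral)
      then have "D 1 q \<subseteq> Poly_Mapping.keys m" by (simp add: strand_def split: if_splits)
      with D_1[OF q(1)] show ?thesis by blast
    qed
    ultimately show "u \<in> {u \<in> free_mod {0}. u 0 \<in> edge_ideal E}"
      by (simp add: edge_ideal_eq)
  qed
  show "{u \<in> free_mod {0}. u 0 \<in> edge_ideal E} \<subseteq> mat_vec (B 1) (lift_mat 0) ` free_mod (B 1)"
  proof safe
    fix u :: "nat \<Rightarrow> ('v, 'k) polys"
    assume u: "u \<in> free_mod {0}" "u 0 \<in> edge_ideal E"
    have "u \<in> mat_vec (B (Suc 0)) (lift_mat 0) ` free_mod (B (Suc 0))"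
    proof (rule lift_mat_image)
      show "u \<in> free_mod (B 0)" using u(1) B_0 by simp
      fix \<alpha> :: "'v \<Rightarrow>\<^sub>0 nat"
      let ?Im = "mat_vec (B (Suc 0)) (c 0) ` free_mod {q \<in> B (Suc 0). D (Suc 0) q \<subseteq> Poly_Mapping.keys \<alpha>}"
      have eq: "strand 0 \<alpha> u = (\<lambda>p. Poly_Mapping.lookup (u 0) \<alpha> * unit_vec 0 p)"
      proof
        fix p
        show "strand 0 \<alpha> u p = Poly_Mapping.lookup (u 0) \<alpha> * unit_vec 0 p"
          using u(1) by (cases "p = 0") (simp_all add: strand_def D_0 unit_vec_def free_mod_def)
      qed
      show "strand 0 \<alpha> u \<in> ?Im"
      proof (cases "Poly_Mapping.lookup (u 0) \<alpha> = 0")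
        case True
        then have "strand 0 \<alpha> u = 0" by (simp add: eq fun_eq_iff)
        then show ?thesis using fun_space.subspace_0[OF subspace_mat_vec_image] by simp
      next
        case False
        then have "\<alpha> \<in> Poly_Mapping.keys (u 0)" by (simp add: in_keys_iff)
        then obtain e where "e \<in> E" "e \<subseteq> Poly_Mapping.keys \<alpha>"
          using u(2) unfolding edge_ideal_eq by blast
        from exact_0[OF this] have "unit_vec 0 \<in> ?Im" by simp
        from fun_space.subspace_scale[OF subspace_mat_vec_image this] show ?thesis
          unfolding eq .
      qed
    qed
    then show "u \<in> mat_vec (B 1) (lift_mat 0) ` free_mod (B 1)" by simp
  qed
qed

lemma homogeneous_single:
  assumes "k = int (card U)"
  shows "homogeneous k (Poly_Mapping.single (vars_exp U) a :: ('v, 'k) polys)"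
proof -
  have "(\<Sum>v\<in>UNIV. Poly_Mapping.lookup (vars_exp U) v) = card U"
    by (simp add: lookup_vars_exp sum.If_cases)
  then show ?thesis using assms by (auto simp: homogeneous_def simp del: of_nat_sum split: if_splits)
qed

lemma lift_mat_homogeneous:
  "homogeneous (int (card (D (Suc i) q)) - int (card (D i p))) (lift_mat i p q)"
proof (cases "c i p q = 0")
  case True
  then show ?thesis by (simp add: lift_mat_def homogeneous_def)
next
  case False
  then have "D i p \<subseteq> D (Suc i) q" using c_degree by blast
  then show ?thesis unfolding lift_mat_def
    by (intro homogeneous_single) (simp add: card_Diff_subset card_mono of_nat_diff)
qed

text \<open>The strict inclusion in \<open>c_degree\<close> leaves at least one variable in the
  monomial.\<close>

lemma lift_mat_irrelevant: "lift_mat i p q \<in> irrelevant_ideal"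
proof (cases "c i p q = 0")
  case True
  then show ?thesis
    by (simp add: lift_mat_def irrelevant_ideal_def ideal_gen_def ring_module.span_zero)
next
  case False
  then have "D (Suc i) q - D i p \<noteq> {}" using c_degree by blast
  then show ?thesis unfolding lift_mat_def by (rule single_in_irrelevant_ideal)
qed

text \<open>The record resolves the ideal, so its level 0 is \<open>B 1\<close>, and the ring at
  \<open>B 0\<close> becomes the target of \<open>aug\<close>. Sets are coarsened to their
  sizes.\<close>

definition lift_complex :: "('v, 'k) polys graded_complex" where
  "lift_complex = \<lparr>basis = \<lambda>i. B (Suc i), shift = \<lambda>i q. int (card (D (Suc i) q)),
     diff = \<lambda>i. lift_mat (Suc i), aug = lift_mat 0 0\<rparr>"

lemma lift_complex_diff_map: "diff_map lift_complex i = mat_vec (B (Suc (Suc i))) (lift_mat (Suc i))"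
  using lift_mat_matrices[of "Suc i"]
  by (auto simp: diff_map_def lift_complex_def mat_vec_def matrices_def fun_eq_iff)

lemma lift_complex_aug_map: "mat_vec (B 1) (lift_mat 0) u = (\<lambda>p. if p = 0 then aug_map lift_complex u else 0)"
  using lift_mat_matrices[of 0] B_0
  by (auto simp: aug_map_def lift_complex_def mat_vec_def matrices_def fun_eq_iff)

lemma lift_complex_minimal: "minimal_graded_free_resolution (edge_ideal E) lift_complex"
  unfolding minimal_graded_free_resolution_def graded_free_resolution_def
proof (intro conjI allI ballI)
  have [simp]: "basis lift_complex i = B (Suc i)" "shift lift_complex i q = int (card (D (Suc i) q))"
    "diff lift_complex i = lift_mat (Suc i)" "aug lift_complex = lift_mat 0 0" for i q
    by (simp_all add: lift_complex_def)
  show "finite (basis lift_complex i)" for i by (simp add: finite_B)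
  show "\<exists>l. \<forall>i>l. basis lift_complex i = {}"
    using length by (intro exI[of _ "card (UNIV :: 'v set)"]) simp
  show "homogeneous (shift lift_complex (i + 1) q - shift lift_complex i p) (diff lift_complex i p q)" for i p q
    using lift_mat_homogeneous[of "Suc i" q p] by simp
  show "homogeneous (shift lift_complex 0 q) (aug lift_complex q)" for q
    using lift_mat_homogeneous[of 0 q 0] by (simp add: D_0)
  show "diff lift_complex i p q \<in> irrelevant_ideal" for i p q
    by (simp add: lift_mat_irrelevant)
  have exact: "u \<in> mat_vec (B (Suc (Suc i))) (lift_mat (Suc i)) ` free_mod (B (Suc (Suc i)))"
    if "u \<in> free_mod (B (Suc i))" "mat_vec (B (Suc i)) (lift_mat i) u = 0" for i u
    using lift_mat_exact that by (simp add: exact_on_def)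
  have square: "mat_vec (B (Suc i)) (lift_mat i) (mat_vec (B (Suc (Suc i))) (lift_mat (Suc i)) w) = 0" for i w
    using lift_mat_exact by (simp add: exact_on_def complex_on_def mat_vec_mat_vec)
  have im: "mat_vec (B (Suc (Suc i))) (lift_mat (Suc i)) w \<in> free_mod (B (Suc i))" for i w
    using lift_mat_matrices[of "Suc i"] by (simp add: mat_vec_def matrices_def free_mod_def)
  show "{u \<in> free_mod (basis lift_complex (i + 1)). diff_map lift_complex i u = (\<lambda>_. 0)} =
    diff_map lift_complex (i + 1) ` free_mod (basis lift_complex (i + 2))" for i
    unfolding lift_complex_diff_map zero_fun_def[symmetric]
    using exact[of _ "Suc i"] square im by auto
  have aug: "aug_map lift_complex u = 0 \<longleftrightarrow> mat_vec (B (Suc 0)) (lift_mat 0) u = 0" for u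
    using lift_complex_aug_map[of u] by (auto simp: fun_eq_iff split: if_splits)
  show "{u \<in> free_mod (basis lift_complex 0). aug_map lift_complex u = 0} =
    diff_map lift_complex 0 ` free_mod (basis lift_complex 1)"
    unfolding lift_complex_diff_map aug
    using exact[of _ 0] square im by auto
  show "aug_map lift_complex ` free_mod (basis lift_complex 0) = edge_ideal E"
  proof -
    have "aug_map lift_complex ` free_mod (B 1) = (\<lambda>u. u 0) ` mat_vec (B 1) (lift_mat 0) ` free_mod (B 1)"
      by (simp add: image_image lift_complex_aug_map del: One_nat_def)
    also have "\<dots> = edge_ideal E"
    proof
      show "edge_ideal E \<subseteq> (\<lambda>u. u 0) ` mat_vec (B 1) (lift_mat 0) ` free_mod (B 1)"
      proof
        fix f :: "('v, 'k) polys" assume "f \<in> edge_ideal E"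
        then have "(\<lambda>p. if p = 0 then f else 0) \<in> mat_vec (B 1) (lift_mat 0) ` free_mod (B 1)"
          unfolding lift_mat_0_image by (auto simp: free_mod_def)
        then show "f \<in> (\<lambda>u. u 0) ` mat_vec (B 1) (lift_mat 0) ` free_mod (B 1)"
          by (rule rev_image_eqI) simp
      qed
    qed (unfold lift_mat_0_image, auto)
    finally show ?thesis by simp
  qed
qed

end

section \<open>Betti numbers and the chosen resolution\<close>

definition level_basis :: "'r graded_complex \<Rightarrow> nat \<Rightarrow> nat set" where
  "level_basis F i = (case i of 0 \<Rightarrow> {0} | Suc i \<Rightarrow> basis F i)"

text \<open>With the ring as level 0 on the single basis element 0, the augmentation becomes the
  first differential and \<open>exact_on\<close> covers the whole resolution.\<close>

definition level_mat :: "'r::comm_ring_1 graded_complex \<Rightarrow> nat \<Rightarrow> nat \<Rightarrow> nat \<Rightarrow> 'r" where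
  "level_mat F i p q = (if p \<in> level_basis F i \<and> q \<in> basis F i
     then (case i of 0 \<Rightarrow> aug F q | Suc i \<Rightarrow> diff F i p q) else 0)"

lemma level_basis_simps [simp]: "level_basis F 0 = {0}" "level_basis F (Suc i) = basis F i"
  by (simp_all add: level_basis_def)

lemma mat_vec_level_mat:
  "mat_vec (basis F 0) (level_mat F 0) u = (\<lambda>p. if p = 0 then aug_map F u else 0)"
  "mat_vec (basis F (Suc i)) (level_mat F (Suc i)) u = diff_map F i u"
  by (auto simp: mat_vec_def level_mat_def aug_map_def diff_map_def fun_eq_iff)

lemma graded_free_resolution_exact:
  assumes "graded_free_resolution I F"
  shows "exact_on (level_basis F) (level_mat F)"
    and "mat_vec (basis F 0) (level_mat F 0) ` free_mod (basis F 0) = {u \<in> free_mod {0}. u 0 \<in> I}"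
proof -
  have fin: "finite (basis F i)" for i
    using assms by (simp add: graded_free_resolution_def)
  have aug_im: "aug_map F ` free_mod (basis F 0) = I"
    using assms by (simp add: graded_free_resolution_def)
  have ex0: "{u \<in> free_mod (basis F 0). aug_map F u = 0} = diff_map F 0 ` free_mod (basis F 1)"
    using assms by (simp add: graded_free_resolution_def)
  have exS: "{u \<in> free_mod (basis F (Suc i)). diff_map F i u = 0} =
    diff_map F (Suc i) ` free_mod (basis F (Suc (Suc i)))" for i
    using assms by (simp add: graded_free_resolution_def zero_fun_def)
  have aug0: "mat_vec (basis F 0) (level_mat F 0) u = 0 \<longleftrightarrow> aug_map F u = 0" for u
    by (auto simp: mat_vec_level_mat fun_eq_iff)
  have mats: "level_mat F i \<in> matrices (level_basis F i) (level_basis F (Suc i))" for i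
    by (simp add: matrices_def level_mat_def)
  have exact: "{u \<in> free_mod (level_basis F (Suc i)). mat_vec (level_basis F (Suc i)) (level_mat F i) u = 0} =
    mat_vec (level_basis F (Suc (Suc i))) (level_mat F (Suc i)) ` free_mod (level_basis F (Suc (Suc i)))" for i
  proof (cases i)
    case 0
    then show ?thesis using ex0 by (simp add: aug0 mat_vec_level_mat(2))
  next
    case (Suc j)
    then show ?thesis using exS[of j] by (simp add: mat_vec_level_mat(2))
  qed
  have "mat_mult (level_basis F (Suc i)) (level_mat F i) (level_mat F (Suc i)) = 0" for i
  proof (rule mat_mult_zeroI[OF _ mats])
    show "finite (level_basis F (Suc (Suc i)))" using fin by simp
    show "mat_vec (level_basis F (Suc i)) (level_mat F i)
      (mat_vec (level_basis F (Suc (Suc i))) (level_mat F (Suc i)) w) = 0"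
      if "w \<in> free_mod (level_basis F (Suc (Suc i)))" for w
      using that exact[of i] by blast
  qed
  moreover have "finite (level_basis F i)" for i
    using fin by (cases i) simp_all
  ultimately show "exact_on (level_basis F) (level_mat F)"
    unfolding exact_on_def complex_on_def using mats exact by blast
  show "mat_vec (basis F 0) (level_mat F 0) ` free_mod (basis F 0) = {u \<in> free_mod {0}. u 0 \<in> I}"
  proof
    show "mat_vec (basis F 0) (level_mat F 0) ` free_mod (basis F 0) \<subseteq> {u \<in> free_mod {0}. u 0 \<in> I}"
      using aug_im by (auto simp: mat_vec_level_mat free_mod_def)
    show "{u \<in> free_mod {0}. u 0 \<in> I} \<subseteq> mat_vec (basis F 0) (level_mat F 0) ` free_mod (basis F 0)"
    proof safe
      fix u assume u: "u \<in> free_mod {0}" "u 0 \<in> I"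
      then obtain w where "w \<in> free_mod (basis F 0)" "u 0 = aug_map F w"
        using aug_im by blast
      moreover from this u(1) have "u = mat_vec (basis F 0) (level_mat F 0) w"
        by (auto simp: mat_vec_level_mat free_mod_def fun_eq_iff)
      ultimately show "u \<in> mat_vec (basis F 0) (level_mat F 0) ` free_mod (basis F 0)" by blast
    qed
  qed
qed

text \<open>Since a minimal resolution exists, \<open>SOME\<close> picks one. Its levels are finite,
  and grouping a level by \<open>shift\<close> counts every basis element once.\<close>

lemma betti_eq_card:
  assumes "minimal_graded_free_resolution I F"
  shows "betti I i = card (basis (minimal_resolution I) i)"
proof -
  define G where "G = minimal_resolution I"
  have "minimal_graded_free_resolution I G"
    unfolding G_def minimal_resolution_def using assms by (rule someI)
  then have fin: "finite (basis G i)"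
    by (simp add: minimal_graded_free_resolution_def graded_free_resolution_def)
  have "betti I i = Sum_any (\<lambda>a. card {b \<in> basis G i. shift G i b = a})"
    by (simp add: betti_def graded_betti_def[abs_def] G_def)
  also have "\<dots> = (\<Sum>a\<in>shift G i ` basis G i. card {b \<in> basis G i. shift G i b = a})"
    using fin by (intro Sum_any.expand_superset) (auto simp: card_eq_0_iff)
  also have "\<dots> = card (basis G i)"
    unfolding card_eq_sum by (rule sum.image_gen[OF fin, symmetric])
  finally show ?thesis by (simp add: G_def)
qed

lemma (in squarefree_resolution) card_le_betti: "card (B (Suc i)) \<le> betti (edge_ideal E :: ('v, 'k) polys set) i"
proof -
  let ?I = "edge_ideal E :: ('v, 'k) polys set"
  define F where "F = minimal_resolution ?I"
  have "minimal_graded_free_resolution ?I F"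
    unfolding F_def minimal_resolution_def using lift_complex_minimal by (rule someI)
  then have F: "graded_free_resolution ?I F" by (simp add: minimal_graded_free_resolution_def)
  have "card (B (Suc i)) \<le> card (level_basis F (Suc i))"
  \<comment> \<open>The squarefree resolution is the minimal complex here, and reduction modulo the
    irrelevant ideal is the constant coefficient.\<close>
  proof (rule minimal_rank_le[OF lift_mat_exact graded_free_resolution_exact(1)[OF F] B_0,
        where \<epsilon> = "\<lambda>f. Poly_Mapping.lookup f 0"])
    show "mat_vec (B 1) (lift_mat 0) ` free_mod (B 1) =
      mat_vec (level_basis F 1) (level_mat F 0) ` free_mod (level_basis F 1)"
      using graded_free_resolution_exact(2)[OF F] lift_mat_0_image by simp
    show "Poly_Mapping.lookup (lift_mat (Suc i) p q) 0 = 0" for i p q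
      by (rule irrelevant_ideal_lookup_0[OF lift_mat_irrelevant])
  qed (simp_all add: lookup_add lookup_mult_0)
  then show ?thesis using betti_eq_card[OF lift_complex_minimal] by (simp add: F_def)
qed

section \<open>Monochromatic sets of a hypertree\<close>

lemma hypertree_card:
  assumes "hypertree V E" "hypergraph_degree E = d" "e \<in> E"
  shows "card e = d"
proof -
  have "card f = card e" if "f \<in> E" for f
    using assms(1,3) that unfolding hypertree_def pure_def by blast
  then have "card ` E = {card e}"
    using assms(3) by blast
  then show ?thesis using assms(2) by (simp add: hypergraph_degree_def)
qed

lemma coloring_inj_on_edge:
  assumes "coloring UNIV E d \<kappa>" "e \<in> E"
  shows "inj_on \<kappa> e"
  using assms by (auto simp: coloring_def inj_on_def)

text \<open>An edge has d vertices of distinct colours, and only d colours are available.\<close>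

lemma edge_has_color:
  fixes E :: "'v::finite set set"
  assumes "coloring UNIV E d \<kappa>" "e \<in> E" "card e = d" "i \<in> {1..d}"
  shows "\<exists>u\<in>e. \<kappa> u = i"
proof -
  have "card (\<kappa> ` e) = card {1..d}" using coloring_inj_on_edge[OF assms(1,2)] assms(3) by (simp add: card_image)
  moreover have "\<kappa> ` e \<subseteq> {1..d}" using assms(1) by (auto simp: coloring_def)
  ultimately have "\<kappa> ` e = {1..d}" by (intro card_subset_eq) auto
  with assms(4) show ?thesis by (metis image_iff)
qed

context squarefree_resolution
begin

text \<open>The degree of \<open>b\<close> lies in \<open>Y \<union> A\<close> and \<open>Y\<close>
  avoids colour \<open>i\<close>; hence colour and degree together determine
  \<open>A\<close>.\<close>

lemma color_class_basis_element:
  assumes color: "coloring UNIV E d \<kappa>" and card: "\<And>e. e \<in> E \<Longrightarrow> card e = d"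
    and E': "E' \<subseteq> E" and A: "A \<subseteq> \<Union>E'" "A \<subseteq> \<kappa> -` {i}" "i \<in> {1..d}"
  shows "\<exists>b\<in>B (card A). A \<subseteq> D (card A) b \<and> D (card A) b \<subseteq> \<Union>E' \<and> D (card A) b \<inter> \<kappa> -` {i} = A"
proof -
  define P where "P = \<Union>E' \<inter> \<kappa> -` {i}"
  define Y where "Y = \<Union>E' - \<kappa> -` {i}"
  have "\<not> (\<exists>e\<in>E. e \<subseteq> Y)"
    using edge_has_color[OF color _ card A(3)] by (fastforce simp: Y_def)
  moreover have "\<exists>e\<in>E. e \<subseteq> insert x Y" if x: "x \<in> P" for x
  proof -
    obtain e where e: "e \<in> E'" "x \<in> e" "\<kappa> x = i" using x by (auto simp: P_def)
    have "inj_on \<kappa> e" using e(1) E' by (intro coloring_inj_on_edge[OF color]) auto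
    then have "\<kappa> u \<noteq> i" if "u \<in> e" "u \<noteq> x" for u
      using e(2,3) that inj_onD by metis
    then have "e \<subseteq> insert x Y" using e by (auto simp: Y_def)
    with e(1) E' show ?thesis by blast
  qed
  moreover have "Y \<inter> P = {}" "A \<subseteq> P" using A by (auto simp: P_def Y_def)
  ultimately obtain b where b: "b \<in> B (card A)" "A \<subseteq> D (card A) b" "D (card A) b \<subseteq> Y \<union> A"
    using exists_basis_element[of Y P A] by blast
  moreover have "D (card A) b \<subseteq> \<Union>E'" "D (card A) b \<inter> \<kappa> -` {i} = A"
    using b A by (auto simp: Y_def)
  ultimately show ?thesis by blast
qed

text \<open>A monochromatic set \<open>A\<close> is recovered from the degree \<open>W\<close> of its basis element: \<open>A\<close> and \<open>W\<close> are
  first covered by the same initial segment of edges, and the vertex completing this segment is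
  unique and lies in \<open>A\<close>. Its colour \<open>i\<close> gives \<open>A = W \<inter> \<kappa> -` {i}\<close>.\<close>

lemma sum_choose_le_card:
  assumes tree: "hypertree UNIV E" and cover: "\<Union>E = UNIV" and deg: "hypergraph_degree E = d"
    and color: "coloring UNIV E d \<kappa>" and j: "j \<ge> 2"
  shows "(\<Sum>i=1..d. card (\<kappa> -` {i}) choose j) \<le> card (B j)"
proof -
  have card_e: "card e = d" if "e \<in> E" for e using hypertree_card[OF tree deg that] .
  obtain Fs where Fs: "set Fs = E" "\<And>i. 1 \<le> i \<Longrightarrow> i < length Fs \<Longrightarrow> card (Fs ! i - \<Union> (set (take i Fs))) = 1"
    using tree by (auto simp: hypertree_def)
  define V where "V = (\<lambda>k. \<Union> (set (take k Fs)))"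
  have V_Suc: "V (Suc k) = V k \<union> Fs ! k" if "k < length Fs" for k
    using that by (auto simp: V_def take_Suc_conv_app_nth)
  have V_end: "V (length Fs) = UNIV" using Fs(1) cover by (simp add: V_def)
  define first where "first = (\<lambda>A. LEAST k. A \<subseteq> V k)"
  have first: "A \<subseteq> V (first A)" for A
    unfolding first_def using V_end by (metis (mono_tags, lifting) LeastI subset_UNIV)
  have first_le: "first A \<le> k" if "A \<subseteq> V k" for A k
    unfolding first_def using that by (rule Least_le)
  define monochromatic where "monochromatic = (\<Union>i\<in>{1..d}. {A. A \<subseteq> \<kappa> -` {i} \<and> card A = j})"
  have new: "\<exists>v\<in>A. V (first A) - V (first A - 1) = {v}" if A: "A \<in> monochromatic" for A
  proof -
    obtain i where i: "A \<subseteq> \<kappa> -` {i}" "card A = j" using A by (auto simp: monochromatic_def)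
    have len: "first A \<le> length Fs" using first_le V_end by blast
    have "A \<noteq> {}" using i(2) j by auto
    then have "first A \<noteq> 0"
      using first[of A] by (metis V_def Union_empty empty_set subset_empty take0)
    \<comment> \<open>\<open>V 1\<close> is a single edge, whose colours are distinct, whereas
      \<open>A\<close> has at least two vertices of one colour.\<close>
    moreover have "first A \<noteq> 1"
    proof
      assume 1: "first A = 1"
      then have "0 < length Fs" using len by linarith
      moreover have "A \<subseteq> V 1" using first[of A] 1 by simp
      ultimately have "A \<subseteq> Fs ! 0" "Fs ! 0 \<in> E"
        using V_Suc[of 0] Fs(1) by (auto simp: fun_cong[OF V_def, of 0])
      then have "inj_on \<kappa> A" using coloring_inj_on_edge[OF color] inj_on_subset by blast
      then have "card (\<kappa> ` A) = j" using i(2) by (simp add: card_image)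
      moreover have "card (\<kappa> ` A) \<le> card {i}" using i(1) by (intro card_mono) auto
      ultimately show False using j by simp
    qed
    ultimately obtain k where k: "first A = Suc k" "1 \<le> k" by (cases "first A") auto
    have "V (Suc k) - V k = Fs ! k - V k" using V_Suc[of k] len k by auto
    then have "card (V (Suc k) - V k) = 1" using Fs(2)[of k] len k by (simp add: V_def)
    then obtain v where v: "V (Suc k) - V k = {v}" by (auto simp: card_1_singleton_iff)
    have "\<not> A \<subseteq> V k" using first_le[of A k] k by auto
    then have "v \<in> A" using first[of A] v k by auto
    with v k show ?thesis by auto
  qed
  have "\<exists>b\<in>B j. A \<subseteq> D j b \<and> D j b \<subseteq> V (first A) \<and> (\<forall>i. A \<subseteq> \<kappa> -` {i} \<longrightarrow> D j b \<inter> \<kappa> -` {i} = A)"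
    if A: "A \<in> monochromatic" for A
  proof -
    obtain i where i: "i \<in> {1..d}" "A \<subseteq> \<kappa> -` {i}" "card A = j" using A by (auto simp: monochromatic_def)
    \<comment> \<open>\<open>A\<close> contains the completing vertex, so it is nonempty and has
      only one colour.\<close>
    have unique: "i' = i" if "A \<subseteq> \<kappa> -` {i'}" for i' using that i(2) new[OF A] by auto
    have "set (take (first A) Fs) \<subseteq> E" using Fs(1) set_take_subset by fast
    from color_class_basis_element[OF color card_e this _ i(2,1)] first[of A]
    obtain b where "b \<in> B j" "A \<subseteq> D j b" "D j b \<subseteq> V (first A)" "D j b \<inter> \<kappa> -` {i} = A"
      unfolding V_def i(3) by blast
    with unique show ?thesis by blast
  qed
  then have "\<forall>A\<in>monochromatic. \<exists>b. b \<in> B j \<and> A \<subseteq> D j b \<and> D j b \<subseteq> V (first A) \<and>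
    (\<forall>i. A \<subseteq> \<kappa> -` {i} \<longrightarrow> D j b \<inter> \<kappa> -` {i} = A)" by blast
  from bchoice[OF this] obtain b where "\<forall>A\<in>monochromatic. b A \<in> B j \<and> A \<subseteq> D j (b A) \<and>
    D j (b A) \<subseteq> V (first A) \<and> (\<forall>i. A \<subseteq> \<kappa> -` {i} \<longrightarrow> D j (b A) \<inter> \<kappa> -` {i} = A)"
    by (elim exE)
  then have b: "\<And>A. A \<in> monochromatic \<Longrightarrow> b A \<in> B j"
    "\<And>A. A \<in> monochromatic \<Longrightarrow> A \<subseteq> D j (b A)" "\<And>A. A \<in> monochromatic \<Longrightarrow> D j (b A) \<subseteq> V (first A)"
    "\<And>A i. A \<in> monochromatic \<Longrightarrow> A \<subseteq> \<kappa> -` {i} \<Longrightarrow> D j (b A) \<inter> \<kappa> -` {i} = A"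
    by blast+
  \<comment> \<open>The degree lies between \<open>A\<close> and \<open>V (first A)\<close>, so no
    shorter segment covers it.\<close>
  have first_b: "first (D j (b A)) = first A" if "A \<in> monochromatic" for A
    using first_le[OF b(3)[OF that]] first_le[of A "first (D j (b A))"] b(2)[OF that] first[of "D j (b A)"]
    by force
  have "inj_on b monochromatic"
  proof
    fix A A' assume A: "A \<in> monochromatic" "A' \<in> monochromatic" "b A = b A'"
    then have eq: "first A = first A'" using first_b[of A] first_b[of A'] by simp
    obtain v where v: "v \<in> A" "V (first A) - V (first A - 1) = {v}" using new[OF A(1)] by blast
    obtain v' where v': "v' \<in> A'" "V (first A') - V (first A' - 1) = {v'}" using new[OF A(2)] by blast
    have "v = v'" using v(2) v'(2) eq by simp
    then have "A \<subseteq> \<kappa> -` {\<kappa> v}" "A' \<subseteq> \<kappa> -` {\<kappa> v}"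
      using A(1,2) v(1) v'(1) by (auto simp: monochromatic_def)
    then show "A = A'" using b(4)[of A] b(4)[of A'] A by metis
  qed
  moreover have "b ` monochromatic \<subseteq> B j" using b(1) by blast
  ultimately have "card monochromatic \<le> card (B j)"
    using finite_B by (rule card_inj_on_le)
  moreover have "card monochromatic = (\<Sum>i=1..d. card {A. A \<subseteq> \<kappa> -` {i} \<and> card A = j})"
    unfolding monochromatic_def
  proof (rule card_UN_disjoint)
    show "\<forall>i\<in>{1..d}. \<forall>i'\<in>{1..d}. i \<noteq> i' \<longrightarrow>
      {A. A \<subseteq> \<kappa> -` {i} \<and> card A = j} \<inter> {A. A \<subseteq> \<kappa> -` {i'} \<and> card A = j} = {}"
    proof (intro ballI impI equals0I)
      fix i i' A assume "i \<noteq> i'"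
        and A: "A \<in> {A. A \<subseteq> \<kappa> -` {i} \<and> card A = j} \<inter> {A. A \<subseteq> \<kappa> -` {i'} \<and> card A = j}"
      have "A \<noteq> {}" using A j by auto
      with A \<open>i \<noteq> i'\<close> show False by auto
    qed
  qed simp_all
  ultimately show ?thesis by (simp add: n_subsets)
qed

end

theorem theorem3p1:
  fixes E :: "'v::finite set set"
    and \<kappa> :: "'v \<Rightarrow> nat"
    and d j :: nat
    and I :: "('v, 'k::field) polys set"
  assumes "d \<ge> 1"
    and "hypertree UNIV E"
    and "\<Union> E = UNIV"
    and "hypergraph_degree E = d"
    and "coloring UNIV E d \<kappa>"
    and "I = edge_ideal E"
    and "j \<ge> 2"
  shows "betti I (j - 1) \<ge> (\<Sum>i=1..d. card (\<kappa> -` {i}) choose j)"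
proof -
  have "{} \<notin> E"
    using hypertree_card[OF assms(2,4), of "{}"] assms(1) by auto
  then obtain B D and c :: "nat \<Rightarrow> nat \<Rightarrow> nat \<Rightarrow> 'k" where "squarefree_resolution E B D c"
    using squarefree_resolution_exists by blast
  then interpret squarefree_resolution E B D c .
  \<comment> \<open>Level 0 is the ring, so level \<open>j\<close> belongs to the Betti number with
    index \<open>j - 1\<close>.\<close>
  have "(\<Sum>i=1..d. card (\<kappa> -` {i}) choose j) \<le> card (B (Suc (j - 1)))"
    using sum_choose_le_card[OF assms(2-5,7)] assms(7) by simp
  also have "\<dots> \<le> betti I (j - 1)"
    unfolding assms(6) by (rule card_le_betti)
  finally show ?thesis .
qed

end
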